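(* Let $m\in\mathbb{N}$ and let $p_1,\ldots,p_m$ be minimal idempotents in $(\beta\mathbb{N},+)$. Then for every $A\in\bigotimes_{i=1}^m p_i$ and every $T\in\mathcal{P}_f(\mathbb{P})$ there exist functions $\alpha_1,\ldots,\alpha_m:\mathcal{P}_f(\mathbb{N}^{\mathbb{N}})\to\mathbb{N}$ and $H_1,\ldots,H_m:\mathcal{P}_f(\mathbb{N}^{\mathbb{N}})\to\mathcal{P}_f(\mathbb{N})$ such that (1) if $G,K\in\mathcal{P}_f(\mathbb{N}^{\mathbb{N}})$ and $G\subsetneq K$, then $H_i(G)<H_i(K)$ for every $i\in\{1,\ldots,m\}$; and (2) if $n\in\mathbb{N}$ with $n\ge m$, and $G_1\subsetneq G_2\subsetneq\cdots\subsetneq G_n$ in $\mathcal{P}_f(\mathbb{N}^{\mathbb{N}})$, then for all $\beta_1<\beta_2<\cdots<\beta_m$ in $\mathcal{P}_f(\mathbb{N})$ with $\max\beta_m\le n$, all $f_i\in G_i$ ($i\in\{1,\ldots,n\}$), and all $P_1,\ldots,P_m\in T$, $$\left(\sum_{i\in\beta_1}\alpha_1(G_i)+P_1\Bigl(\sum_{i\in\beta_1}\sum_{t\in H_1(G_i)}f_i(t)\Bigr),\ldots,\sum_{i\in\beta_m}\alpha_m(G_i)+P_m\Bigl(\sum_{i\in\beta_m}\sum_{t\in H_m(G_i)}f_i(t)\Bigr)\right)\in A.$$ In fact, the same holds for arbitrary idempotents $p_1,\ldots,p_m$ of $(\mathcal{J}_p,+)$ (in place of minimal idempotents).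
   Context: $\mathbb{N}$ is the set of positive integers; $\mathcal{P}_f(X)$ is the set of nonempty finite subsets of $X$; $\mathbb{N}^{\mathbb{N}}$ is the set of all functions $\mathbb{N}\to\mathbb{N}$. For $\beta,\gamma\in\mathcal{P}_f(\mathbb{N})$, $\beta<\gamma$ means $\max\beta<\min\gamma$. $\mathbb{P}$ is the set of one-variable polynomials with integer coefficients and zero constant term. $\beta\mathbb{N}$ is the set of ultrafilters on $\mathbb{N}$, with the Stone topology and the operation: $A\in p+q$ iff $\{x\in\mathbb{N}:-x+A\in q\}\in p$, where $-x+A=\{y\in\mathbb{N}:x+y\in A\}$. An ultrafilter $p$ is idempotent if $p+p=p$; a minimal idempotent is an idempotent lying in $K(\beta\mathbb{N},+)$, the smallest two-sided ideal (the union of all minimal left ideals) of $(\beta\mathbb{N},+)$. A set $A\subseteq\mathbb{N}$ is a $J_p$-set if for every $F\in\mathcal{P}_f(\mathbb{P})$ and every $H\in\mathcal{P}_f(\mathbb{N}^{\mathbb{N}})$ there exist $a\in\mathbb{N}$ and $\beta\in\mathcal{P}_f(\mathbb{N})$ such that $a+P(\sum_{t\in\beta}f(t))\in A$ for all $P\in F$ and $f\in H$. $\mathcal{J}_p=\{q\in\beta\mathbb{N}:\text{every }A\in q\text{ is a }J_p\text{-set}\}$ (the subscript $p$ stands for "polynomial" and is not an ultrafilter); it is a two-sided ideal of $(\beta\mathbb{N},+)$. Tensor products: for ultrafilters $p_1,\ldots,p_k$ on $\mathbb{N}$, $\bigotimes_{i=1}^k p_i$ is the ultrafilter on $\mathbb{N}^k$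 defined recursively by $\bigotimes_{i=1}^1p_i=p_1$, and, for $A\subseteq\mathbb{N}^{k+1}$, $A\in\bigotimes_{i=1}^{k+1}p_i$ iff $\{(x_1,\ldots,x_k)\in\mathbb{N}^k:\{x_{k+1}\in\mathbb{N}:(x_1,\ldots,x_{k+1})\in A\}\in p_{k+1}\}\in\bigotimes_{i=1}^kp_i$. *)

theory Defs
  imports "HOL-Library.FuncSet" "HOL-Computational_Algebra.Polynomial"
begin

text \<open>The positive integers are the subset \<open>Pos\<close> of \<^typ>\<open>nat\<close>, and
  functions on them are extensional, so that inclusion between sets of functions is not
  affected by values at 0.\<close>

abbreviation Pos :: "nat set" where
  "Pos \<equiv> {0<..}"

definition NN :: "(nat \<Rightarrow> nat) set" where
  "NN = Pos \<rightarrow>\<^sub>E Pos"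

definition Pf :: "'a set \<Rightarrow> 'a set set" where
  "Pf X = {F. F \<subseteq> X \<and> finite F \<and> F \<noteq> {}}"

definition set_less :: "nat set \<Rightarrow> nat set \<Rightarrow> bool"  (infix "\<lless>" 50) where
  "\<beta> \<lless> \<gamma> \<longleftrightarrow> Max \<beta> < Min \<gamma>"

definition PP :: "int poly set" where
  "PP = {P. coeff P 0 = 0}"

definition ultrafilter_on :: "'a set \<Rightarrow> 'a set set \<Rightarrow> bool" where
  "ultrafilter_on X U \<longleftrightarrow>
     U \<subseteq> Pow X \<and> X \<in> U \<and> {} \<notin> U \<and>
     (\<forall>A\<in>U. \<forall>B\<in>U. A \<inter> B \<in> U) \<and>
     (\<forall>A\<in>U. \<forall>B. A \<subseteq> B \<and> B \<subseteq> X \<longrightarrow> B \<in> U) \<and>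
     (\<forall>A. A \<subseteq> X \<longrightarrow> A \<in> U \<or> X - A \<in> U)"

definition betaN :: "nat set set set" where
  "betaN = {p. ultrafilter_on Pos p}"

definition usum :: "nat set set \<Rightarrow> nat set set \<Rightarrow> nat set set"  (infixl "\<oplus>\<^sub>u" 65) where
  "p \<oplus>\<^sub>u q = {A. A \<subseteq> Pos \<and> {x \<in> Pos. {y \<in> Pos. x + y \<in> A} \<in> q} \<in> p}"

definition two_sided_ideal :: "nat set set set \<Rightarrow> bool" where
  "two_sided_ideal I \<longleftrightarrow>
     I \<subseteq> betaN \<and> I \<noteq> {} \<and> (\<forall>p\<in>betaN. \<forall>q\<in>I. p \<oplus>\<^sub>u q \<in> I \<and> q \<oplus>\<^sub>u p \<in> I)"

text \<open>A smallest two-sided ideal exists because \<open>\<beta>\<nat>\<close> is a compact right topological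
  semigroup; as the following lemma shows, it is then the intersection of all two-sided ideals.\<close>

definition K_betaN :: "nat set set set" where
  "K_betaN = \<Inter>{I. two_sided_ideal I}"

lemma K_betaN_eq_smallest:
  assumes "two_sided_ideal I" and "\<And>J. two_sided_ideal J \<Longrightarrow> I \<subseteq> J"
  shows "K_betaN = I"
  using assms unfolding K_betaN_def by blast

definition idempotent :: "nat set set \<Rightarrow> bool" where
  "idempotent p \<longleftrightarrow> p \<in> betaN \<and> p \<oplus>\<^sub>u p = p"

definition minimal_idempotent :: "nat set set \<Rightarrow> bool" where
  "minimal_idempotent p \<longleftrightarrow> idempotent p \<and> p \<in> K_betaN"

text \<open>Values of integer polynomials may be negative or zero, so membership in a set of positive
  integers is expressed after embedding that set into \<^typ>\<open>int\<close>.\<close>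

definition Jp_set :: "nat set \<Rightarrow> bool" where
  "Jp_set A \<longleftrightarrow> A \<subseteq> Pos \<and>
     (\<forall>F\<in>Pf PP. \<forall>H\<in>Pf NN. \<exists>a\<in>Pos. \<exists>\<beta>\<in>Pf Pos.
        \<forall>P\<in>F. \<forall>f\<in>H. int a + poly P (\<Sum>t\<in>\<beta>. int (f t)) \<in> int ` A)"

definition Jp :: "nat set set set" where
  "Jp = {q \<in> betaN. \<forall>A\<in>q. Jp_set A}"

definition tuples :: "nat \<Rightarrow> nat list set" where
  "tuples k = {xs. length xs = k \<and> set xs \<subseteq> Pos}"

text \<open>The tensor product of \<open>p 1, \<dots>, p k\<close>, with k-tuples as lists of length k. The recursion
  starts from the only ultrafilter on the one-point set of 0-tuples; lemma \<open>tensor_1\<close> gives the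
  usual starting point.\<close>

primrec tensor :: "(nat \<Rightarrow> nat set set) \<Rightarrow> nat \<Rightarrow> nat list set set" where
  "tensor p 0 = {{[]}}"
| "tensor p (Suc k) =
     {A. A \<subseteq> tuples (Suc k) \<and>
         {xs \<in> tuples k. {x \<in> Pos. xs @ [x] \<in> A} \<in> p (Suc k)} \<in> tensor p k}"

lemma tensor_1: "tensor p 1 = {A. A \<subseteq> tuples 1 \<and> {x \<in> Pos. [x] \<in> A} \<in> p 1}"
proof -
  have "tuples 0 = {[]}"
    unfolding tuples_def by auto
  then have "{xs \<in> tuples 0. Q xs} = {[]} \<longleftrightarrow> Q []" for Q
    by auto
  then show ?thesis
    unfolding One_nat_def tensor.simps singleton_iff by simp
qed

text \<open>The existence of \<open>\<alpha>\<^sub>1, \<dots>, \<alpha>\<^sub>m\<close> and \<open>H\<^sub>1, \<dots>, H\<^sub>m\<close> for given \<open>A\<close> and \<open>T\<close>. All finite families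
  are indexed from 1; values outside the stated index ranges are irrelevant.\<close>

definition polynomial_central_conclusion :: "nat \<Rightarrow> nat list set \<Rightarrow> int poly set \<Rightarrow> bool" where
  "polynomial_central_conclusion m A T \<longleftrightarrow>
     (\<exists>(\<alpha> :: nat \<Rightarrow> (nat \<Rightarrow> nat) set \<Rightarrow> nat) (H :: nat \<Rightarrow> (nat \<Rightarrow> nat) set \<Rightarrow> nat set).
        (\<forall>i\<in>{1..m}. \<alpha> i \<in> Pf NN \<rightarrow> Pos) \<and>
        (\<forall>i\<in>{1..m}. H i \<in> Pf NN \<rightarrow> Pf Pos) \<and>
        (\<forall>G\<in>Pf NN. \<forall>K\<in>Pf NN. G \<subset> K \<longrightarrow> (\<forall>i\<in>{1..m}. H i G \<lless> H i K)) \<and>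
        (\<forall>n\<ge>m. \<forall>G :: nat \<Rightarrow> (nat \<Rightarrow> nat) set.
           (\<forall>i\<in>{1..n}. G i \<in> Pf NN) \<and> (\<forall>i\<in>{1..<n}. G i \<subset> G (Suc i)) \<longrightarrow>
           (\<forall>(\<beta> :: nat \<Rightarrow> nat set) (f :: nat \<Rightarrow> nat \<Rightarrow> nat) (P :: nat \<Rightarrow> int poly).
              (\<forall>j\<in>{1..m}. \<beta> j \<in> Pf Pos) \<and> (\<forall>j\<in>{1..<m}. \<beta> j \<lless> \<beta> (Suc j)) \<and>
              Max (\<beta> m) \<le> n \<and>
              (\<forall>i\<in>{1..n}. f i \<in> G i) \<and>
              (\<forall>j\<in>{1..m}. P j \<in> T) \<longrightarrow>
              map (\<lambda>j. (\<Sum>i\<in>\<beta> j. int (\<alpha> j (G i))) +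
                        poly (P j) (\<Sum>i\<in>\<beta> j. \<Sum>t\<in>H j (G i). int (f i t))) [1..<Suc m]
                \<in> map int ` A)))"

end

theory Submission
  imports Defs "HOL-Computational_Algebra.Fundamental_Theorem_Algebra"
    "HOL-Library.Multiset" "HOL-Library.Function_Algebras"
begin

text \<open>A minimal idempotent lies in every two-sided ideal, so the first part reduces to the second
  once \<open>Jp\<close> is known to be nonempty. By compactness this amounts to a van der Waerden theorem for
  polynomials evaluated at finite sums of several sequences at once. It is proved, in Walters' style,
  by colour focusing and PET induction for polynomials over an arbitrary commutative ring; the several
  sequences become one sequence in a ring of functions.

  For idempotents of \<open>Jp\<close> the values at a finite set \<open>G\<close> of functions are chosen by recursion on
  \<open>G\<close>. Only finitely many partial blocks can be formed below \<open>G\<close>; each of them imposes a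
  member of \<open>p j\<close>, and one application of the \<open>Jp\<close> property to the intersection of these members
  serves them all.\<close>

section \<open>Polynomial recurrence along finite sums\<close>

text \<open>In the recurrence, one a and one \<beta> must serve all sequences at once. Each sequence
  gets a coordinate of its own, a polynomial for it acts on this coordinate alone, and adding up the
  coordinates brings the values back to the integers. In the recursion the obstacle is that P(s + u)
  differs from P(s) + P(u), so the value of a block does not determine its continuations: the
  partial sums x of the \<alpha> and s of the f are recorded separately. Appending a set changes x +
  P(s) by a + P(s + u) - P(s), and P(s + u) - P(s) is a polynomial in u without constant term, to
  which the \<open>Jp\<close> property applies. Where a block ends, and with which P, is known only
  later; hence x + P(s) must lie, for every P in \<open>T\<close> and after each appended set, in a
  set of values at which the block may end as well as go on. The star set of an idempotent allows
  both.\<close>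

lemma lead_coeff_offset_poly: "coeff (offset_poly p h) (degree p) = lead_coeff p"
proof (induction p)
  case 0
  then show ?case by (simp add: offset_poly_0)
next
  case (pCons a p)
  show ?case
  proof (cases "p = 0")
    case False
    have "coeff (offset_poly p h) (Suc (degree p)) = 0"
      by (rule coeff_eq_0) simp
    with False pCons.IH show ?thesis
      by (simp add: offset_poly_pCons)
  qed (simp add: offset_poly_0 offset_poly_pCons)
qed

section \<open>PET induction: classes of polynomials by degree and leading coefficient\<close>

definition lead :: "'a::zero poly \<Rightarrow> nat \<times> 'a" where
  "lead p = (degree p, lead_coeff p)"

text \<open>The measure of the PET induction: replacing every \<open>p\<close> by \<open>shift_diff q h p\<close> with \<open>q\<close> of least
  degree merges the class of \<open>q\<close> into lower degrees, permutes the other classes of degree at least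
  \<open>degree q\<close>, and creates new classes only below \<open>degree q\<close>.\<close>

definition weight :: "'a::zero poly set \<Rightarrow> nat multiset" where
  "weight A = image_mset fst (mset_set (lead ` (A - {0})))"

text \<open>This is what becomes of p when the index set \<alpha> of a focused colour is enlarged by
  a disjoint \<beta> and the focus moves back by q; h is the sum over \<alpha>. It vanishes at 0
  whenever q does.\<close>

definition shift_diff :: "'a::comm_ring_1 poly \<Rightarrow> 'a \<Rightarrow> 'a poly \<Rightarrow> 'a poly" where
  "shift_diff q h p = offset_poly p h - [:poly p h:] - q"

lemma poly_shift_diff: "poly (shift_diff q h p) x = poly p (h + x) - poly p h - poly q x"
  by (simp add: shift_diff_def poly_offset_poly)

text \<open>Translation keeps the leading coefficient, so the top coefficient can change only
  through q, which needs equal degrees. If it cancelled, the result would drop below the degree of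
  q, contrary to the third assumption.\<close>

lemma lead_shift_diff:
  fixes p q :: "'a::comm_ring_1 poly"
  assumes "degree q \<le> degree p" "0 < degree q" "degree q \<le> degree (shift_diff q h p)"
  shows "lead p \<noteq> lead q \<and> lead (shift_diff q h p) =
    (degree p, if degree p = degree q then lead_coeff p - lead_coeff q else lead_coeff p)"
proof -
  let ?s = "shift_diff q h p"
  have top: "coeff ?s (degree p) = lead_coeff p - coeff q (degree p)"
    using assms lead_coeff_offset_poly[of p h] by (simp add: shift_diff_def coeff_pCons split: nat.split)
  have le: "degree ?s \<le> degree p"
    unfolding shift_diff_def using assms by (intro degree_diff_le) auto
  have eq: "degree ?s = degree p"
  proof (rule ccontr)
    assume "degree ?s \<noteq> degree p"
    with le assms(1,3) have lt: "degree ?s < degree p" "degree q < degree p" by auto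
    then have "coeff ?s (degree p) = 0" "coeff q (degree p) = 0"
      by (auto intro: coeff_eq_0)
    with top have "lead_coeff p = 0" by simp
    then have "p = 0" by simp
    with assms show False by simp
  qed
  have "coeff ?s (degree p) \<noteq> 0"
  proof
    assume "coeff ?s (degree p) = 0"
    then have "lead_coeff ?s = 0" using eq by simp
    then have "?s = 0" by (simp only: leading_coeff_0_iff)
    with assms show False by simp
  qed
  with top eq assms(1) show ?thesis
    by (auto simp: lead_def coeff_eq_0)
qed

lemma weight_shift_diff_less:
  fixes A :: "'a::comm_ring_1 poly set"
  assumes "finite A" "finite B" "q \<in> A" "0 \<notin> A" "0 < degree q"
    and min: "\<And>p. p \<in> A \<Longrightarrow> degree q \<le> degree p"
    and B: "B \<subseteq> {shift_diff q h p | h p. p \<in> A}"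
  shows "(weight B, weight A) \<in> mult less_than"
proof -
  let ?d = "degree q"
  define hi where "hi = {l \<in> lead ` (B - {0}). ?d \<le> fst l}"
  define lo where "lo = {l \<in> lead ` (B - {0}). fst l < ?d}"
  \<comment> \<open>\<open>sh\<close> is the action of \<open>shift_diff\<close> on the classes
    whose degree stays at least \<open>?d\<close>; it does not depend on h and is injective.\<close>
  define sh where "sh = (\<lambda>(n, c). (n, if n = ?d then c - lead_coeff q else c))"
  have fin: "finite hi" "finite lo"
    using assms by (auto simp: hi_def lo_def)
  have split: "lead ` (B - {0}) = hi \<union> lo" "hi \<inter> lo = {}"
    by (auto simp: hi_def lo_def)
  have inj: "inj sh"
    by (auto simp: inj_def sh_def split: if_splits)
  have fst_sh: "fst (sh l) = fst l" for l
    by (simp add: sh_def split: prod.split)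
  let ?C = "lead ` A - {lead q}"
  have "hi \<subseteq> sh ` ?C"
  proof
    fix l assume "l \<in> hi"
    then have l: "l \<in> lead ` (B - {0})" "?d \<le> fst l"
      by (simp_all add: hi_def)
    then obtain s where s: "s \<in> B" "l = lead s" by blast
    then obtain p h where p: "p \<in> A" "l = lead (shift_diff q h p)" "?d \<le> degree (shift_diff q h p)"
      using B l(2) unfolding lead_def by fastforce
    from lead_shift_diff[OF min[OF p(1)] assms(5) p(3)]
    have "lead p \<noteq> lead q" "l = sh (lead p)"
      by (auto simp: p(2) sh_def lead_def)
    with p(1) show "l \<in> sh ` ?C" by auto
  qed
  then have "mset_set hi \<subseteq># mset_set (sh ` ?C)"
    using assms(1) by (intro subset_imp_msubset_mset_set) auto
  then have "image_mset fst (mset_set hi) \<subseteq># image_mset fst (mset_set (sh ` ?C))"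
    by (rule image_mset_subseteq_mono)
  also have "\<dots> = image_mset fst (image_mset sh (mset_set ?C))"
    using inj by (subst image_mset_mset_set) (auto intro: inj_on_subset)
  also have "\<dots> = image_mset fst (mset_set ?C)"
    by (simp add: multiset.map_comp comp_def fst_sh)
  finally have sub: "image_mset fst (mset_set hi) \<subseteq># image_mset fst (mset_set ?C)" .
  have A: "weight A = image_mset fst (mset_set ?C) + {#?d#}"
  proof -
    have "lead ` (A - {0}) = insert (lead q) ?C"
      using assms by auto
    moreover have "mset_set (insert (lead q) ?C) = add_mset (lead q) (mset_set ?C)"
      using assms(1) by (intro mset_set.insert) auto
    moreover have "fst (lead q) = ?d"
      by (simp add: lead_def)
    ultimately show ?thesis
      by (simp only: weight_def) simp
  qed
  have wB: "weight B = image_mset fst (mset_set hi) + image_mset fst (mset_set lo)"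
    unfolding weight_def split(1) using fin split(2) by (simp add: mset_set_Union)
  \<comment> \<open>What \<open>A\<close> has beyond the surviving classes contains
    \<open>?d\<close>, from the class of q, and every degree in \<open>lo\<close> lies below
    \<open>?d\<close>.\<close>
  let ?J = "image_mset fst (mset_set ?C) - image_mset fst (mset_set hi) + {#?d#}"
  have "weight A = image_mset fst (mset_set hi) + ?J"
    unfolding A using sub by simp
  moreover have "(image_mset fst (mset_set hi) + image_mset fst (mset_set lo),
      image_mset fst (mset_set hi) + ?J) \<in> mult less_than"
    using fin by (intro one_step_implies_mult) (auto simp: lo_def)
  ultimately show ?thesis
    unfolding wB by simp
qed

section \<open>Colour focusing along finite sums\<close>

text \<open>\<open>M\<close> and \<open>S\<close> do not depend on the colouring: the focusing step recolours a point by the pattern of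
  colours on a finite set of translates, which must be known beforehand.\<close>

definition ip_recurrent :: "(nat \<Rightarrow> 'a::comm_ring_1) \<Rightarrow> 'a poly set \<Rightarrow> bool" where
  "ip_recurrent g A \<longleftrightarrow> (\<forall>(r::nat) (N::nat). \<exists>M\<ge>N. \<exists>S. finite S \<and>
     (\<forall>c \<in> UNIV \<rightarrow> {..<r}. \<exists>a\<in>S. \<exists>\<beta>. \<beta> \<noteq> {} \<and> \<beta> \<subseteq> {N<..M} \<and>
        (\<forall>p\<in>A. c (a + poly p (sum g \<beta>)) = c a)))"

text \<open>Each colour may use its own index set. Once \<open>K\<close> contains the colour of the
  focus \<open>a\<close> itself, the set for that colour solves the recurrence.\<close>

definition focused :: "(nat \<Rightarrow> 'a::comm_ring_1) \<Rightarrow> 'a poly set \<Rightarrow> nat \<Rightarrow> nat \<Rightarrow> ('a \<Rightarrow> nat) \<Rightarrow> 'a \<Rightarrow> nat set \<Rightarrow> bool" where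
  "focused g A N M c a K \<longleftrightarrow>
     (\<forall>k\<in>K. \<exists>\<alpha>. \<alpha> \<noteq> {} \<and> \<alpha> \<subseteq> {N<..M} \<and> (\<forall>p\<in>A. c (a + poly p (sum g \<alpha>)) = k))"

text \<open>Induction on the number s of focused colours: either a solution exists or a further
  colour is gained, and with s = r the colour of the focus is among them.\<close>

lemma ip_recurrent_focusing:
  fixes g :: "nat \<Rightarrow> 'a::comm_ring_1"
  assumes fin: "finite A" and zero: "\<And>p. p \<in> A \<Longrightarrow> poly p 0 = 0" and q: "q \<in> A"
    and rec: "\<And>M. ip_recurrent g {shift_diff q (sum g \<alpha>) p | \<alpha> p. \<alpha> \<subseteq> {..M} \<and> p \<in> A}"
  shows "ip_recurrent g A"
proof -
  have foc: "\<exists>M\<ge>N. \<exists>S. finite S \<and> (\<forall>c \<in> UNIV \<rightarrow> {..<r}.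
      (\<exists>a\<in>S. \<exists>\<beta>. \<beta> \<noteq> {} \<and> \<beta> \<subseteq> {N<..M} \<and> (\<forall>p\<in>A. c (a + poly p (sum g \<beta>)) = c a)) \<or>
      (\<exists>a\<in>S. \<exists>K \<subseteq> {..<r}. card K = s \<and> focused g A N M c a K))" for r N s
  proof (induction s)
    case 0
    have "\<forall>c\<in>UNIV \<rightarrow> {..<r}. \<exists>a\<in>{0}. \<exists>K\<subseteq>{..<r}. card K = 0 \<and> focused g A N N c a K"
      by (auto simp: focused_def intro!: exI[of _ "{}"])
    then show ?case by (intro exI[of _ N] conjI exI[of _ "{0}"]) auto
  next
    case (Suc s)
    then obtain M S where M: "N \<le> M" "finite S" and S: "\<And>c. c \<in> UNIV \<rightarrow> {..<r} \<Longrightarrow>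
      (\<exists>a\<in>S. \<exists>\<beta>. \<beta> \<noteq> {} \<and> \<beta> \<subseteq> {N<..M} \<and> (\<forall>p\<in>A. c (a + poly p (sum g \<beta>)) = c a)) \<or>
      (\<exists>a\<in>S. \<exists>K \<subseteq> {..<r}. card K = s \<and> focused g A N M c a K)"
      by auto
    \<comment> \<open>\<open>B\<close> holds the foci and all their translates along subsets of
      \<open>{..M}\<close>; the colour patterns on \<open>B\<close>, numbered by \<open>e\<close>,
      are the colours to which \<open>rec\<close> is applied.\<close>
    define B where "B = S \<union> (\<lambda>(a, p, \<alpha>). a + poly p (sum g \<alpha>)) ` (S \<times> A \<times> Pow {..M})"
    have "finite B" using M(2) fin by (auto simp: B_def)
    define pats where "pats = B \<rightarrow>\<^sub>E {..<r}"
    have "finite pats" unfolding pats_def using \<open>finite B\<close> by (intro finite_PiE) auto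
    then obtain e r' where e: "bij_betw e pats {..<r'::nat}"
      using ex_bij_betw_finite_nat[of pats] by (auto simp: atLeast0LessThan)
    define A' where "A' = {shift_diff q (sum g \<alpha>) p | \<alpha> p. \<alpha> \<subseteq> {..M} \<and> p \<in> A}"
    obtain M' S' where M': "M \<le> M'" "finite S'" and S': "\<And>c. c \<in> UNIV \<rightarrow> {..<r'} \<Longrightarrow>
      \<exists>a\<in>S'. \<exists>\<beta>. \<beta> \<noteq> {} \<and> \<beta> \<subseteq> {M<..M'} \<and> (\<forall>p\<in>A'. c (a + poly p (sum g \<beta>)) = c a)"
      using rec[of M, folded A'_def, unfolded ip_recurrent_def, THEN spec, of r', THEN spec, of M] by auto
    \<comment> \<open>The points x + a serve when a solution is inherited from the pattern, the
      others are the new foci. As \<beta> is found only after the colouring is given, all subsets of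
      \<open>{..M'}\<close> are allowed.\<close>
    define S'' where "S'' = (\<lambda>(x, a). x + a) ` (S' \<times> S) \<union>
      (\<lambda>(x, a, \<beta>). x + a - poly q (sum g \<beta>)) ` (S' \<times> S \<times> Pow {..M'})"
    have "finite S''" using M(2) M'(2) by (auto simp: S''_def)
    have main: "(\<exists>a\<in>S''. \<exists>\<beta>. \<beta> \<noteq> {} \<and> \<beta> \<subseteq> {N<..M'} \<and> (\<forall>p\<in>A. c (a + poly p (sum g \<beta>)) = c a)) \<or>
      (\<exists>a\<in>S''. \<exists>K \<subseteq> {..<r}. card K = Suc s \<and> focused g A N M' c a K)"
      (is "?mono \<or> ?foc") if c: "c \<in> UNIV \<rightarrow> {..<r}" for c
    proof -
      \<comment> \<open>All points \<open>x + p(\<beta>)\<close> with \<open>p\<close> in \<open>A'\<close> see the same colours on \<open>B\<close>. Hence moving the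
        focus of the pattern at \<open>x\<close> back by \<open>q(\<beta>)\<close> keeps its colours, with \<open>\<alpha> \<union> \<beta>\<close> for \<open>\<alpha>\<close>, and
        adds the colour of the old focus, with \<open>\<beta>\<close>.\<close>
      define pat where "pat x = restrict (\<lambda>y. c (x + y)) B" for x
      have pat: "pat x \<in> pats" for x
        using c by (auto simp: pat_def pats_def)
      have "(\<lambda>x. e (pat x)) \<in> UNIV \<rightarrow> {..<r'}"
        using e pat by (auto simp: bij_betw_def)
      from S'[OF this] obtain x \<beta> where x: "x \<in> S'" "\<beta> \<noteq> {}" "\<beta> \<subseteq> {M<..M'}"
        and ep: "\<And>p. p \<in> A' \<Longrightarrow> e (pat (x + poly p (sum g \<beta>))) = e (pat x)"
        by blast
      have eqp: "pat (x + poly p (sum g \<beta>)) = pat x" if "p \<in> A'" for p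
        using ep[OF that] e pat by (auto simp: bij_betw_def inj_on_def)
      have col: "c (x + poly p (sum g \<beta>) + y) = c (x + y)" if "p \<in> A'" "y \<in> B" for p y
        using fun_cong[OF eqp[OF that(1)], of y] that(2) by (simp add: pat_def)
      have fb: "finite \<beta>" using x(3) finite_subset by blast
      have shiftc: "(\<lambda>y. c (x + y)) \<in> UNIV \<rightarrow> {..<r}" using c by auto
      have mono: ?mono if "a \<in> S" "\<gamma> \<noteq> {}" "\<gamma> \<subseteq> {N<..M}"
        "\<forall>p\<in>A. c (x + (a + poly p (sum g \<gamma>))) = c (x + a)" for a \<gamma>
      proof (intro bexI exI conjI)
        show "x + a \<in> S''" using that(1) x(1) by (auto simp: S''_def)
        have "{N<..M} \<subseteq> {N<..M'}" using M'(1) by auto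
        with that(3) show "\<gamma> \<subseteq> {N<..M'}" by (rule subset_trans)
        show "\<forall>p\<in>A. c (x + a + poly p (sum g \<gamma>)) = c (x + a)"
          using that(4) by (simp only: add.assoc)
      qed fact
      from S[OF shiftc] show ?thesis
      proof
        assume "\<exists>a\<in>S. \<exists>\<beta>. \<beta> \<noteq> {} \<and> \<beta> \<subseteq> {N<..M} \<and>
          (\<forall>p\<in>A. c (x + (a + poly p (sum g \<beta>))) = c (x + a))"
        then have ?mono by (elim bexE exE conjE) (rule mono)
        then show ?thesis ..
      next
        assume "\<exists>a\<in>S. \<exists>K\<subseteq>{..<r}. card K = s \<and> focused g A N M (\<lambda>y. c (x + y)) a K"
        then obtain a K where a: "a \<in> S" "K \<subseteq> {..<r}" "card K = s"
          and fc: "focused g A N M (\<lambda>y. c (x + y)) a K" by blast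
        show ?thesis
        proof (cases "c (x + a) \<in> K")
          case True
          from bspec[OF fc[unfolded focused_def] this] obtain \<gamma> where
            "\<gamma> \<noteq> {}" "\<gamma> \<subseteq> {N<..M}" "\<forall>p\<in>A. c (x + (a + poly p (sum g \<gamma>))) = c (x + a)"
            by blast
          with a(1) have ?mono by (rule mono)
          then show ?thesis ..
        next
          case False
          let ?f = "x + a - poly q (sum g \<beta>)"
          have "?f \<in> S''" using x(1,3) a(1) by (force simp: S''_def)
          moreover have "insert (c (x + a)) K \<subseteq> {..<r}" using a(2) c by auto
          moreover have "card (insert (c (x + a)) K) = Suc s"
            using False a(2,3) finite_subset[OF a(2)] by simp
          moreover have new: "c (?f + poly p (sum g (\<alpha> \<union> \<beta>))) = c (x + (a + poly p (sum g \<alpha>)))"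
            if "p \<in> A" "\<alpha> \<subseteq> {..M}" for p \<alpha>
          proof -
            have "\<alpha> \<inter> \<beta> = {}" using that(2) x(3) by force
            moreover have "finite \<alpha>" using that(2) finite_subset by blast
            ultimately have "sum g (\<alpha> \<union> \<beta>) = sum g \<alpha> + sum g \<beta>"
              using fb by (simp add: sum.union_disjoint)
            then have "?f + poly p (sum g (\<alpha> \<union> \<beta>)) =
              x + poly (shift_diff q (sum g \<alpha>) p) (sum g \<beta>) + (a + poly p (sum g \<alpha>))"
              by (simp add: poly_shift_diff algebra_simps)
            moreover have "a + poly p (sum g \<alpha>) \<in> B"
              using that a(1) by (force simp: B_def)
            moreover have "shift_diff q (sum g \<alpha>) p \<in> A'"
              using that by (auto simp: A'_def)
            ultimately show ?thesis by (simp only: col)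
          qed
          moreover have "focused g A N M' c ?f (insert (c (x + a)) K)"
            unfolding focused_def
          proof
            fix k assume "k \<in> insert (c (x + a)) K"
            then have "\<exists>\<alpha>. \<alpha> \<subseteq> {N<..M} \<and> (\<forall>p\<in>A. c (x + (a + poly p (sum g \<alpha>))) = k)"
            proof
              assume "k = c (x + a)"
              \<comment> \<open>The old focus is the translate along the empty set, as p(0) = 0, so
                its colour is handled like the others.\<close>
              then show ?thesis using zero by (intro exI[of _ "{}"]) simp
            next
              assume "k \<in> K"
              from bspec[OF fc[unfolded focused_def] this] show ?thesis by blast
            qed
            then obtain \<alpha> where \<alpha>: "\<alpha> \<subseteq> {N<..M}" "\<forall>p\<in>A. c (x + (a + poly p (sum g \<alpha>))) = k"
              by blast
            then have "\<alpha> \<subseteq> {..M}" by auto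
            with new \<alpha>(2) have "\<forall>p\<in>A. c (?f + poly p (sum g (\<alpha> \<union> \<beta>))) = k" by auto
            moreover have "\<alpha> \<union> \<beta> \<subseteq> {N<..M'}" using \<alpha>(1) x(3) M(1) M'(1) by fastforce
            ultimately show "\<exists>\<alpha>. \<alpha> \<noteq> {} \<and> \<alpha> \<subseteq> {N<..M'} \<and> (\<forall>p\<in>A. c (?f + poly p (sum g \<alpha>)) = k)"
              using x(2) by (intro exI[of _ "\<alpha> \<union> \<beta>"] conjI) auto
          qed
          ultimately have ?foc by (intro bexI[of _ ?f] exI[of _ "insert (c (x + a)) K"] conjI)
          then show ?thesis ..
        qed
      qed
    qed
    show ?case
      using M(1) M'(1) \<open>finite S''\<close> main by (intro exI[of _ M'] conjI exI[of _ S'']) auto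
  qed
  show ?thesis unfolding ip_recurrent_def
  proof (intro allI)
    fix r N
    from foc[of N r r] obtain M S where M: "N \<le> M" "finite S" and S: "\<And>c. c \<in> UNIV \<rightarrow> {..<r} \<Longrightarrow>
      (\<exists>a\<in>S. \<exists>\<beta>. \<beta> \<noteq> {} \<and> \<beta> \<subseteq> {N<..M} \<and> (\<forall>p\<in>A. c (a + poly p (sum g \<beta>)) = c a)) \<or>
      (\<exists>a\<in>S. \<exists>K \<subseteq> {..<r}. card K = r \<and> focused g A N M c a K)"
      by auto
    have "\<exists>a\<in>S. \<exists>\<beta>. \<beta> \<noteq> {} \<and> \<beta> \<subseteq> {N<..M} \<and> (\<forall>p\<in>A. c (a + poly p (sum g \<beta>)) = c a)"
      if c: "c \<in> UNIV \<rightarrow> {..<r}" for c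
      using S[OF c]
    proof
      assume "\<exists>a\<in>S. \<exists>K\<subseteq>{..<r}. card K = r \<and> focused g A N M c a K"
      then obtain a K where a: "a \<in> S" "K \<subseteq> {..<r}" "card K = r" "focused g A N M c a K" by blast
      then have "K = {..<r}" by (intro card_subset_eq) auto
      then have "c a \<in> K" using c by auto
      from bspec[OF a(4)[unfolded focused_def] this] show ?thesis
        by (intro bexI[OF _ a(1)])
    qed
    with M show "\<exists>M\<ge>N. \<exists>S. finite S \<and> (\<forall>c\<in>UNIV \<rightarrow> {..<r}. \<exists>a\<in>S. \<exists>\<beta>. \<beta> \<noteq> {} \<and> \<beta> \<subseteq> {N<..M} \<and>
        (\<forall>p\<in>A. c (a + poly p (sum g \<beta>)) = c a))"
      by (intro exI[of _ M] exI[of _ S] conjI ballI)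
  qed
qed

lemma ip_recurrent_insert_0:
  assumes "ip_recurrent g (A - {0})" shows "ip_recurrent g A"
proof -
  have "(\<forall>p\<in>A. c (a + poly p x) = c a) \<longleftrightarrow> (\<forall>p\<in>A - {0}. c (a + poly p x) = c a)"
    for c :: "'a \<Rightarrow> nat" and a x by auto
  then show ?thesis using assms unfolding ip_recurrent_def by simp
qed

theorem ip_polynomial_recurrence:
  fixes g :: "nat \<Rightarrow> 'a::comm_ring_1"
  assumes "finite A" "\<And>p. p \<in> A \<Longrightarrow> poly p 0 = 0"
  shows "ip_recurrent g A"
proof -
  have "wf (inv_image (mult less_than) (weight :: 'a poly set \<Rightarrow> _))"
    by (intro wf_inv_image wf_mult) simp
  then show ?thesis using assms
  proof (induction A rule: wf_induct_rule)
    case (less A)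
    let ?A = "A - {0}"
    show ?case
    proof (rule ip_recurrent_insert_0, cases "?A = {}")
      case True
      show "ip_recurrent g ?A" unfolding True ip_recurrent_def
      proof (intro allI)
        fix r N :: nat
        show "\<exists>M\<ge>N. \<exists>S. finite S \<and> (\<forall>c\<in>UNIV \<rightarrow> {..<r}. \<exists>a\<in>S. \<exists>\<beta>. \<beta> \<noteq> {} \<and> \<beta> \<subseteq> {N<..M} \<and>
            (\<forall>p\<in>{}. c (a + poly p (sum g \<beta>)) = c a))"
          by (intro exI[of _ "Suc N"] conjI exI[of _ "{0}"]) (auto intro!: exI[of _ "{Suc N}"])
      qed
    next
      case False
      have finA: "finite ?A" using less.prems by simp
      define q where "q = arg_min_on degree ?A"
      have q: "q \<in> ?A" and min: "\<And>p. p \<in> ?A \<Longrightarrow> degree q \<le> degree p"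
        using arg_min_if_finite(1)[OF finA False] arg_min_least[OF finA False]
        by (auto simp: q_def)
      have zero: "poly p 0 = 0" if "p \<in> ?A" for p using less.prems that by auto
      have dq: "0 < degree q"
      proof (rule ccontr)
        assume "\<not> 0 < degree q"
        then obtain b where "q = [:b:]" using degree_eq_zeroE by blast
        with zero[OF q] q show False by simp
      qed
      have rec: "ip_recurrent g {shift_diff q (sum g \<alpha>) p | \<alpha> p. \<alpha> \<subseteq> {..M} \<and> p \<in> ?A}" (is "ip_recurrent g ?B") for M
      proof (rule less.IH)
        have "?B = (\<lambda>(\<alpha>, p). shift_diff q (sum g \<alpha>) p) ` (Pow {..M} \<times> ?A)" by auto
        then show finB: "finite ?B" using finA by simp
        have "(weight ?B, weight ?A) \<in> mult less_than"
          using finA finB q dq min by (intro weight_shift_diff_less[where q = q]) auto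
        \<comment> \<open>\<open>weight\<close> discards the zero polynomial, so \<open>A\<close>
          and \<open>?A\<close> have the same weight.\<close>
        then show "(?B, A) \<in> inv_image (mult less_than) weight"
          by (simp add: weight_def)
        show "poly p 0 = 0" if "p \<in> ?B" for p
          using that zero[OF q] by (auto simp: poly_shift_diff)
      qed
      show "ip_recurrent g ?A"
        by (rule ip_recurrent_focusing[OF finA zero q rec])
    qed
  qed
qed

section \<open>From one sequence in a ring of functions to several integer sequences\<close>

lemma sum_fun_apply: "(\<Sum>t\<in>\<beta>. g t) f = (\<Sum>t\<in>\<beta>. g t f)"
  for g :: "'b \<Rightarrow> 'c \<Rightarrow> 'd::comm_monoid_add"
  by (induction \<beta> rule: infinite_finite_induct) auto

text \<open>The coefficients are functions supported at f, so in the pointwise ring evaluation takes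
  place in this coordinate alone.\<close>

definition embed_poly :: "'c \<Rightarrow> int poly \<Rightarrow> ('c \<Rightarrow> int) poly" where
  "embed_poly f P = map_poly (\<lambda>k h. if h = f then k else 0) P"

lemma poly_embed_poly: "poly (embed_poly f P) x = (\<lambda>h. if h = f then poly P (x f) else 0)"
proof (induction P)
  case 0
  then show ?case by (simp add: embed_poly_def fun_eq_iff)
next
  case (pCons k P)
  have "(\<lambda>k h. if h = f then k else 0) 0 = 0"
    by (simp add: fun_eq_iff)
  then have "embed_poly f (pCons k P) = pCons (\<lambda>h. if h = f then k else 0) (embed_poly f P)"
    unfolding embed_poly_def using pCons.hyps by (intro map_poly_pCons) auto
  with pCons.IH show ?case by (simp add: fun_eq_iff)
qed

text \<open>The recurrence is applied to the colouring pulled back along the additive map \<phi>,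
  which adds up the coordinates in \<open>H\<close> and takes the value of an embedded polynomial to
  that of P.\<close>

theorem polynomial_vdW_Pos:
  fixes c :: "nat \<Rightarrow> nat"
  assumes "F \<in> Pf PP" "H \<in> Pf NN" and c: "\<And>y. c y < r"
  shows "\<exists>a\<in>Pos. \<exists>\<beta>\<in>Pf Pos. \<exists>k. \<forall>P\<in>F. \<forall>f\<in>H.
    int a + poly P (\<Sum>t\<in>\<beta>. int (f t)) \<in> int ` {y \<in> Pos. c y = k}"
proof -
  have fin: "finite F" "finite H"
    using assms by (auto simp: Pf_def)
  define g :: "nat \<Rightarrow> (nat \<Rightarrow> nat) \<Rightarrow> int" where "g = (\<lambda>t f. int (f t))"
  define A where "A = (\<lambda>(f, P). embed_poly f P) ` (H \<times> F)"
  define \<phi> :: "((nat \<Rightarrow> nat) \<Rightarrow> int) \<Rightarrow> int" where "\<phi> = (\<lambda>a. \<Sum>f\<in>H. a f)"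
  have \<phi>_add: "\<phi> (a + b) = \<phi> a + \<phi> b" for a b
    by (simp add: \<phi>_def sum.distrib)
  have \<phi>_embed: "\<phi> (poly (embed_poly f P) (sum g \<beta>)) = poly P (\<Sum>t\<in>\<beta>. int (f t))" if "f \<in> H" for f P \<beta>
    using that fin by (simp add: \<phi>_def poly_embed_poly sum_fun_apply g_def sum.delta')
  have zeroP: "poly P 0 = 0" if "P \<in> F" for P
    using assms(1) that by (auto simp: Pf_def PP_def poly_0_coeff_0)
  have "ip_recurrent g A"
    using fin zeroP by (intro ip_polynomial_recurrence) (auto simp: A_def poly_embed_poly fun_eq_iff)
  from this[unfolded ip_recurrent_def, THEN spec, of r, THEN spec, of 0]
  obtain M S where "finite S" and S: "\<forall>c \<in> UNIV \<rightarrow> {..<r}.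
      \<exists>a\<in>S. \<exists>\<beta>. \<beta> \<noteq> {} \<and> \<beta> \<subseteq> {0<..M} \<and> (\<forall>p\<in>A. c (a + poly p (sum g \<beta>)) = c a)"
    by (elim exE conjE) (rule that)
  \<comment> \<open>The colouring lives on the positive integers; only finitely many values matter, so a translation
    by a large \<open>L\<close> makes all of them positive.\<close>
  define V where "V = \<phi> ` S \<union> (\<lambda>(a, p, \<beta>). \<phi> (a + poly p (sum g \<beta>))) ` (S \<times> A \<times> Pow {0<..M})"
  have "finite V" using \<open>finite S\<close> fin by (auto simp: V_def A_def)
  then obtain L where L: "\<And>v. v \<in> V \<Longrightarrow> v + L > 0"
  proof -
    assume *: "\<And>L. (\<And>v. v \<in> V \<Longrightarrow> 0 < v + L) \<Longrightarrow> thesis"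
    show thesis
    proof (rule *[of "1 + (\<Sum>v\<in>V. \<bar>v\<bar>)"])
      fix v assume "v \<in> V"
      then have "\<bar>v\<bar> \<le> (\<Sum>v\<in>V. \<bar>v\<bar>)"
        using \<open>finite V\<close> by (intro member_le_sum) auto
      then show "0 < v + (1 + (\<Sum>v\<in>V. \<bar>v\<bar>))" by linarith
    qed
  qed
  have "(\<lambda>a. c (nat (\<phi> a + L))) \<in> UNIV \<rightarrow> {..<r}" using c by auto
  from bspec[OF S this] obtain a \<beta> where a: "a \<in> S" and \<beta>: "\<beta> \<noteq> {}" "\<beta> \<subseteq> {0<..M}"
    and mono: "\<forall>p\<in>A. c (nat (\<phi> (a + poly p (sum g \<beta>)) + L)) = c (nat (\<phi> a + L))"
    by blast
  show ?thesis
  proof (intro bexI exI ballI)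
    have a_pos: "\<phi> a + L > 0" using a by (intro L) (auto simp: V_def)
    then show "nat (\<phi> a + L) \<in> Pos" by simp
    show "\<beta> \<in> Pf Pos" using \<beta> finite_subset[OF \<beta>(2)] by (auto simp: Pf_def)
    fix P f assume Pf: "P \<in> F" "f \<in> H"
    let ?p = "embed_poly f P"
    let ?y = "\<phi> (a + poly ?p (sum g \<beta>)) + L"
    have "?p \<in> A" using Pf by (auto simp: A_def)
    then have "c (nat ?y) = c (nat (\<phi> a + L))" using mono by blast
    moreover have "?y > 0" using \<open>?p \<in> A\<close> a \<beta>(2) by (intro L) (force simp: V_def)
    moreover have "int (nat (\<phi> a + L)) + poly P (\<Sum>t\<in>\<beta>. int (f t)) = int (nat ?y)"
      using a_pos \<open>?y > 0\<close> by (simp add: \<phi>_add \<phi>_embed[OF Pf(2)])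
    ultimately show "int (nat (\<phi> a + L)) + poly P (\<Sum>t\<in>\<beta>. int (f t)) \<in>
      int ` {y \<in> Pos. c y = c (nat (\<phi> a + L))}"
      by (intro image_eqI[of _ _ "nat ?y"]) auto
  qed
qed

section \<open>The ideal of ultrafilters of polynomial J-sets\<close>

text \<open>A maximal family with the finite intersection property is an ultrafilter. Intersecting
  with \<open>X\<close> lets the empty family, whose intersection is \<open>UNIV\<close>, express
  that \<open>X\<close> is nonempty.\<close>

lemma ultrafilter_extends_fip:
  assumes "\<F> \<subseteq> Pow X" and fip: "\<And>\<G>. finite \<G> \<Longrightarrow> \<G> \<subseteq> \<F> \<Longrightarrow> X \<inter> \<Inter>\<G> \<noteq> {}"
  shows "\<exists>U. ultrafilter_on X U \<and> \<F> \<subseteq> U"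
proof -
  define Z where "Z = {\<H>. \<F> \<subseteq> \<H> \<and> \<H> \<subseteq> Pow X \<and> (\<forall>\<G>. finite \<G> \<longrightarrow> \<G> \<subseteq> \<H> \<longrightarrow> X \<inter> \<Inter>\<G> \<noteq> {})}"
  have "\<F> \<in> Z" using assms by (auto simp: Z_def)
  have "\<exists>U\<in>Z. \<forall>\<H>\<in>Z. U \<subseteq> \<H> \<longrightarrow> \<H> = U"
  proof (rule subset_Zorn_nonempty)
    show "Z \<noteq> {}" using \<open>\<F> \<in> Z\<close> by blast
    fix \<K> assume \<K>: "\<K> \<noteq> {}" "subset.chain Z \<K>"
    then have sub: "\<K> \<subseteq> Z" by (auto simp: subset.chain_def)
    have "X \<inter> \<Inter>\<G> \<noteq> {}" if \<G>: "finite \<G>" "\<G> \<subseteq> \<Union>\<K>" for \<G>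
    proof -
      obtain \<H> where "\<H> \<in> \<K>" "\<G> \<subseteq> \<H>"
        using finite_subset_Union_chain[OF \<G> \<K>] by metis
      with sub \<G>(1) show ?thesis unfolding Z_def by blast
    qed
    moreover have "\<F> \<subseteq> \<H> \<and> \<H> \<subseteq> Pow X" if "\<H> \<in> \<K>" for \<H>
      using sub that by (auto simp: Z_def)
    then have "\<F> \<subseteq> \<Union>\<K>" "\<Union>\<K> \<subseteq> Pow X" using \<K>(1) by (blast, meson Sup_least)
    ultimately show "\<Union>\<K> \<in> Z" by (simp add: Z_def)
  qed
  then obtain U where "U \<in> Z" and max: "\<And>\<H>. \<H> \<in> Z \<Longrightarrow> U \<subseteq> \<H> \<Longrightarrow> \<H> = U" by metis
  then have U: "\<F> \<subseteq> U" "U \<subseteq> Pow X" and fipU: "\<And>\<G>. finite \<G> \<Longrightarrow> \<G> \<subseteq> U \<Longrightarrow> X \<inter> \<Inter>\<G> \<noteq> {}"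
    by (auto simp: Z_def)
  \<comment> \<open>Adjoining such an \<open>A\<close> keeps the finite intersection property, so by
    maximality it is already there.\<close>
  have mem: "A \<in> U" if "A \<subseteq> X" and A: "\<And>\<G>. finite \<G> \<Longrightarrow> \<G> \<subseteq> U \<Longrightarrow> X \<inter> \<Inter>\<G> \<inter> A \<noteq> {}" for A
  proof -
    have "insert A U \<in> Z"
      unfolding Z_def
    proof (intro CollectI conjI allI impI)
      fix \<G> assume "finite \<G>" "\<G> \<subseteq> insert A U"
      then have "X \<inter> \<Inter>(\<G> - {A}) \<inter> A \<noteq> {}" by (intro A) auto
      then show "X \<inter> \<Inter>\<G> \<noteq> {}" by blast
    qed (use U that(1) in auto)
    from max[OF this] show ?thesis by blast
  qed
  have "ultrafilter_on X U"
    unfolding ultrafilter_on_def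
  proof (intro conjI ballI allI impI)
    show "X \<in> U" using fipU by (intro mem) auto
    show "{} \<notin> U" using fipU[of "{{}}"] by auto
    show "A \<inter> B \<in> U" if "A \<in> U" "B \<in> U" for A B
    proof (rule mem)
      fix \<G> assume "finite \<G>" "\<G> \<subseteq> U"
      with that fipU[of "insert A (insert B \<G>)"] show "X \<inter> \<Inter>\<G> \<inter> (A \<inter> B) \<noteq> {}"
        by (simp add: Int_ac)
    qed (use that U in auto)
    show "B \<in> U" if "A \<in> U" "A \<subseteq> B \<and> B \<subseteq> X" for A B
    proof (rule mem)
      fix \<G> assume "finite \<G>" "\<G> \<subseteq> U"
      with that fipU[of "insert A \<G>"] show "X \<inter> \<Inter>\<G> \<inter> B \<noteq> {}" by auto
    qed (use that in auto)
    show "A \<in> U \<or> X - A \<in> U" if "A \<subseteq> X" for A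
    proof (rule disjCI, rule mem)
      fix \<G>1 assume \<G>1: "finite \<G>1" "\<G>1 \<subseteq> U"
      assume "X - A \<notin> U"
      then obtain \<G>2 where \<G>2: "finite \<G>2" "\<G>2 \<subseteq> U" "X \<inter> \<Inter>\<G>2 \<inter> (X - A) = {}"
        using mem[of "X - A"] by auto
      have "X \<inter> \<Inter>(\<G>1 \<union> \<G>2) \<noteq> {}" using \<G>1 \<G>2 by (intro fipU) auto
      with \<G>2(3) show "X \<inter> \<Inter>\<G>1 \<inter> A \<noteq> {}" by auto
    qed (use that in auto)
  qed (use U in auto)
  with U show ?thesis by blast
qed

section \<open>Partition regularity of J_p-sets\<close>

lemma Pf_UN:
  assumes "finite I" "I \<noteq> {}" "\<And>i. i \<in> I \<Longrightarrow> A i \<in> Pf X"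
  shows "(\<Union>i\<in>I. A i) \<in> Pf X"
proof -
  obtain i where "i \<in> I" using assms(2) by blast
  then have "(\<Union>i\<in>I. A i) \<noteq> {}" using assms(3)[of i] by (auto simp: Pf_def)
  with assms show ?thesis by (auto simp: Pf_def)
qed

text \<open>If each cell C fails for some \<open>F C\<close> and \<open>H C\<close>, the unions of
  these give one configuration that fails in every cell, against a monochromatic solution for the
  colouring by cells.\<close>

lemma finite_cover_Jp_set:
  assumes "finite \<C>" "Pos \<subseteq> \<Union>\<C>" "\<And>C. C \<in> \<C> \<Longrightarrow> C \<subseteq> Pos"
  shows "\<exists>C\<in>\<C>. Jp_set C"
proof (rule ccontr)
  assume "\<not> (\<exists>C\<in>\<C>. Jp_set C)"
  then have "\<forall>C\<in>\<C>. \<exists>F\<in>Pf PP. \<exists>H\<in>Pf NN. \<forall>a\<in>Pos. \<forall>\<beta>\<in>Pf Pos.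
      \<not> (\<forall>P\<in>F. \<forall>f\<in>H. int a + poly P (\<Sum>t\<in>\<beta>. int (f t)) \<in> int ` C)"
    using assms(3) by (simp add: Jp_set_def)
  then obtain F H where FH: "\<forall>C\<in>\<C>. F C \<in> Pf PP \<and> H C \<in> Pf NN \<and> (\<forall>a\<in>Pos. \<forall>\<beta>\<in>Pf Pos.
      \<not> (\<forall>P\<in>F C. \<forall>f\<in>H C. int a + poly P (\<Sum>t\<in>\<beta>. int (f t)) \<in> int ` C))"
    unfolding Bex_def by metis
  have "\<C> \<noteq> {}" using assms(2) by auto
  then have F: "\<Union>(F ` \<C>) \<in> Pf PP" and H: "\<Union>(H ` \<C>) \<in> Pf NN"
    using FH assms(1) by (simp_all add: Pf_UN)
  \<comment> \<open>The colouring has to be total on \<open>nat\<close>, so a point outside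
    \<open>Pos\<close> gets an arbitrary cell.\<close>
  have "\<forall>y. \<exists>C\<in>\<C>. y \<in> Pos \<longrightarrow> y \<in> C"
    using assms(2) \<open>\<C> \<noteq> {}\<close> by blast
  then obtain h where h: "\<And>y. h y \<in> \<C>" "\<And>y. y \<in> Pos \<Longrightarrow> y \<in> h y" by metis
  obtain e r where e: "bij_betw e \<C> {..<r::nat}"
    using ex_bij_betw_finite_nat[OF assms(1)] by (auto simp: atLeast0LessThan)
  have "e (h y) < r" for y using e h(1)[of y] by (auto simp: bij_betw_def)
  from polynomial_vdW_Pos[OF F H, of "\<lambda>y. e (h y)", OF this]
  obtain a \<beta> k where a: "a \<in> Pos" "\<beta> \<in> Pf Pos" and
    k: "\<forall>P\<in>\<Union>(F ` \<C>). \<forall>f\<in>\<Union>(H ` \<C>).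
      int a + poly P (\<Sum>t\<in>\<beta>. int (f t)) \<in> int ` {y \<in> Pos. e (h y) = k}"
    by (elim bexE exE) (rule that)
  have "\<exists>C\<in>\<C>. {y \<in> Pos. e (h y) = k} \<subseteq> C"
  proof (cases "k \<in> e ` \<C>")
    case True
    then obtain C where "C \<in> \<C>" "k = e C" by blast
    then show ?thesis using e h by (auto simp: bij_betw_def inj_on_def intro!: bexI[of _ C])
  next
    case False
    then show ?thesis using h(1) \<open>\<C> \<noteq> {}\<close> by blast
  qed
  then obtain C where C: "C \<in> \<C>" "{y \<in> Pos. e (h y) = k} \<subseteq> C" by blast
  have "int a + poly P (\<Sum>t\<in>\<beta>. int (f t)) \<in> int ` C" if "P \<in> F C" "f \<in> H C" for P f
  proof -
    have "P \<in> \<Union>(F ` \<C>)" "f \<in> \<Union>(H ` \<C>)" using that C(1) by auto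
    from bspec[OF bspec[OF k this(1)] this(2)] C(2) show ?thesis
      by blast
  qed
  moreover have "\<not> (\<forall>P\<in>F C. \<forall>f\<in>H C. int a + poly P (\<Sum>t\<in>\<beta>. int (f t)) \<in> int ` C)"
    using FH C(1) a by simp
  ultimately show False by simp
qed

text \<open>By \<open>finite_cover_Jp_set\<close> the complements of the sets that are not J_p have
  the finite intersection property, and an ultrafilter containing them all has only J_p-sets as
  members.\<close>

lemma Jp_nonempty: "Jp \<noteq> {}"
proof -
  define \<F> where "\<F> = {Pos - A | A. A \<subseteq> Pos \<and> \<not> Jp_set A}"
  have "Pos \<inter> \<Inter>\<G> \<noteq> {}" if \<G>: "finite \<G>" "\<G> \<subseteq> \<F>" for \<G>
  proof
    assume empty: "Pos \<inter> \<Inter>\<G> = {}"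
    have "\<exists>C\<in>(\<lambda>B. Pos - B) ` \<G>. Jp_set C"
      using \<G>(1) empty by (intro finite_cover_Jp_set) auto
    then obtain B where "B \<in> \<G>" "Jp_set (Pos - B)" by blast
    moreover from this \<G> obtain A where "B = Pos - A" "A \<subseteq> Pos" "\<not> Jp_set A"
      by (auto simp: \<F>_def)
    moreover from this have "Pos - B = A" by blast
    ultimately show False by simp
  qed
  then obtain q where q: "ultrafilter_on Pos q" "\<F> \<subseteq> q"
    using ultrafilter_extends_fip[of \<F> Pos] by (auto simp: \<F>_def)
  have "Jp_set A" if "A \<in> q" for A
  proof (rule ccontr)
    assume "\<not> Jp_set A"
    moreover have "A \<subseteq> Pos" using that q(1) by (auto simp: ultrafilter_on_def)
    ultimately have "Pos - A \<in> q" using q(2) by (auto simp: \<F>_def)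
    with that q(1) have "A \<inter> (Pos - A) \<in> q" unfolding ultrafilter_on_def by blast
    moreover have "A \<inter> (Pos - A) = {}" by blast
    ultimately show False using q(1) by (simp add: ultrafilter_on_def)
  qed
  with q(1) have "q \<in> Jp" by (auto simp: Jp_def betaN_def)
  then show ?thesis by blast
qed

section \<open>The semigroup of ultrafilters and its ideal \<open>Jp\<close>\<close>

lemma betaN_mono:
  assumes "p \<in> betaN" "A \<in> p" "A \<subseteq> B" "B \<subseteq> Pos"
  shows "B \<in> p"
  using assms by (auto simp: betaN_def ultrafilter_on_def)

lemma betaN_subset: "p \<in> betaN \<Longrightarrow> A \<in> p \<Longrightarrow> A \<subseteq> Pos"
  by (auto simp: betaN_def ultrafilter_on_def)

lemma betaN_Int: "p \<in> betaN \<Longrightarrow> A \<in> p \<Longrightarrow> B \<in> p \<Longrightarrow> A \<inter> B \<in> p"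
  by (auto simp: betaN_def ultrafilter_on_def)

lemma betaN_Pos: "p \<in> betaN \<Longrightarrow> Pos \<in> p"
  by (auto simp: betaN_def ultrafilter_on_def)

lemma betaN_nonempty: "p \<in> betaN \<Longrightarrow> A \<in> p \<Longrightarrow> A \<noteq> {}"
  by (auto simp: betaN_def ultrafilter_on_def)

lemma betaN_Compl_iff:
  assumes "p \<in> betaN" "A \<subseteq> Pos"
  shows "Pos - A \<in> p \<longleftrightarrow> A \<notin> p"
proof -
  have "A \<in> p \<or> Pos - A \<in> p"
    using assms by (auto simp: betaN_def ultrafilter_on_def)
  moreover have "A \<inter> (Pos - A) = {}" by blast
  ultimately show ?thesis
    using betaN_Int[OF assms(1), of A "Pos - A"] betaN_nonempty[OF assms(1)] by auto
qed

lemma betaN_Inter: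
  assumes "p \<in> betaN" "finite \<C>" "\<C> \<subseteq> p"
  shows "Pos \<inter> \<Inter>\<C> \<in> p"
  using assms(2,3)
proof (induction \<C>)
  case (insert C \<C>)
  then have "C \<inter> (Pos \<inter> \<Inter>\<C>) \<in> p"
    using betaN_Int[OF assms(1)] by auto
  moreover have "Pos \<inter> \<Inter>(insert C \<C>) = C \<inter> (Pos \<inter> \<Inter>\<C>)" by blast
  ultimately show ?case by simp
qed (use betaN_Pos[OF assms(1)] in auto)

lemma usum_iff: "A \<in> p \<oplus>\<^sub>u q \<longleftrightarrow> A \<subseteq> Pos \<and> {x \<in> Pos. {y \<in> Pos. x + y \<in> A} \<in> q} \<in> p"
  by (simp add: usum_def)

lemma Jp_setD:
  assumes "Jp_set A" "F \<in> Pf PP" "H \<in> Pf NN"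
  shows "\<exists>a\<in>Pos. \<exists>\<beta>\<in>Pf Pos. \<forall>P\<in>F. \<forall>f\<in>H. int a + poly P (\<Sum>t\<in>\<beta>. int (f t)) \<in> int ` A"
  using assms by (simp add: Jp_set_def)

lemma usum_in_betaN:
  assumes p: "p \<in> betaN" and q: "q \<in> betaN"
  shows "p \<oplus>\<^sub>u q \<in> betaN"
proof -
  define E where "E = (\<lambda>A. {x \<in> Pos. {y \<in> Pos. x + y \<in> A} \<in> q})"
  have iff: "A \<in> p \<oplus>\<^sub>u q \<longleftrightarrow> A \<subseteq> Pos \<and> E A \<in> p" for A
    by (simp add: usum_iff E_def)
  have E_sub: "E A \<subseteq> Pos" for A by (auto simp: E_def)
  have E_Int: "E A \<inter> E B \<subseteq> E (A \<inter> B)" for A B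
  proof
    fix x assume "x \<in> E A \<inter> E B"
    then have "x \<in> Pos" "{y \<in> Pos. x + y \<in> A} \<inter> {y \<in> Pos. x + y \<in> B} \<in> q"
      using betaN_Int[OF q] by (simp_all add: E_def)
    moreover have "{y \<in> Pos. x + y \<in> A} \<inter> {y \<in> Pos. x + y \<in> B} = {y \<in> Pos. x + y \<in> A \<inter> B}"
      by blast
    ultimately show "x \<in> E (A \<inter> B)" by (simp add: E_def)
  qed
  have E_mono: "E A \<subseteq> E B" if "A \<subseteq> B" for A B
  proof
    fix x assume "x \<in> E A"
    then have "x \<in> Pos" "{y \<in> Pos. x + y \<in> A} \<in> q" by (simp_all add: E_def)
    moreover from this(2) have "{y \<in> Pos. x + y \<in> B} \<in> q"
      by (rule betaN_mono[OF q]) (use that in auto)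
    ultimately show "x \<in> E B" by (simp add: E_def)
  qed
  have E_Compl: "Pos - E A = E (Pos - A)" for A
  proof -
    have "{y \<in> Pos. x + y \<in> Pos - A} \<in> q \<longleftrightarrow> {y \<in> Pos. x + y \<in> A} \<notin> q" for x
    proof -
      have "{y \<in> Pos. x + y \<in> Pos - A} = Pos - {y \<in> Pos. x + y \<in> A}" by auto
      moreover have "{y \<in> Pos. x + y \<in> A} \<subseteq> Pos" by blast
      ultimately show ?thesis by (simp only: betaN_Compl_iff[OF q])
    qed
    then show ?thesis unfolding E_def by blast
  qed
  show ?thesis
    unfolding betaN_def ultrafilter_on_def
  proof (intro CollectI conjI ballI allI impI)
    have "E Pos = Pos" using betaN_Pos[OF q] by (auto simp: E_def greaterThan_def)
    then show "Pos \<in> p \<oplus>\<^sub>u q" using betaN_Pos[OF p] by (simp add: iff)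
    have "E {} = {}" using betaN_nonempty[OF q] by (auto simp: E_def)
    then show "{} \<notin> p \<oplus>\<^sub>u q" using betaN_nonempty[OF p] by (auto simp: iff)
    show "p \<oplus>\<^sub>u q \<subseteq> Pow Pos" by (auto simp: iff)
    fix A
    show "A \<inter> B \<in> p \<oplus>\<^sub>u q" if "A \<in> p \<oplus>\<^sub>u q" "B \<in> p \<oplus>\<^sub>u q" for B
    proof -
      have "E A \<inter> E B \<in> p" using that by (intro betaN_Int[OF p]) (simp_all add: iff)
      then have "E (A \<inter> B) \<in> p" by (rule betaN_mono[OF p _ E_Int E_sub])
      then show ?thesis using that by (auto simp: iff)
    qed
    show "B \<in> p \<oplus>\<^sub>u q" if "A \<in> p \<oplus>\<^sub>u q" "A \<subseteq> B \<and> B \<subseteq> Pos" for B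
      using that betaN_mono[OF p _ E_mono E_sub, of A B] by (simp add: iff)
    show "A \<in> p \<oplus>\<^sub>u q \<or> Pos - A \<in> p \<oplus>\<^sub>u q" if "A \<subseteq> Pos"
      using that betaN_Compl_iff[OF p E_sub, of A] by (simp add: iff E_Compl)
  qed
qed

lemma usum_left_Jp:
  assumes p: "p \<in> betaN" and q: "q \<in> Jp"
  shows "p \<oplus>\<^sub>u q \<in> Jp"
proof -
  have "Jp_set A" if A: "A \<in> p \<oplus>\<^sub>u q" for A
    unfolding Jp_set_def
  proof (intro conjI ballI)
    show "A \<subseteq> Pos" using A by (simp add: usum_iff)
    fix F H assume FH: "F \<in> Pf PP" "H \<in> Pf NN"
    obtain x where x: "x \<in> Pos" "{y \<in> Pos. x + y \<in> A} \<in> q"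
      using A betaN_nonempty[OF p, of "{x \<in> Pos. {y \<in> Pos. x + y \<in> A} \<in> q}"] by (auto simp: usum_iff)
    then have "Jp_set {y \<in> Pos. x + y \<in> A}" using q by (simp add: Jp_def)
    from Jp_setD[OF this FH] obtain a \<beta> where a: "a \<in> Pos" "\<beta> \<in> Pf Pos"
      and *: "\<forall>P\<in>F. \<forall>f\<in>H.
        int a + poly P (\<Sum>t\<in>\<beta>. int (f t)) \<in> int ` {y \<in> Pos. x + y \<in> A}"
      by (elim bexE) (rule that)
    show "\<exists>a\<in>Pos. \<exists>\<beta>\<in>Pf Pos. \<forall>P\<in>F. \<forall>f\<in>H. int a + poly P (\<Sum>t\<in>\<beta>. int (f t)) \<in> int ` A"
    proof (intro bexI ballI)
      fix P f assume "P \<in> F" "f \<in> H"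
      from *[rule_format, OF this] obtain y where "int a + poly P (\<Sum>t\<in>\<beta>. int (f t)) = int y" "x + y \<in> A" by auto
      then show "int (x + a) + poly P (\<Sum>t\<in>\<beta>. int (f t)) \<in> int ` A"
        by (intro image_eqI[of _ _ "x + y"]) auto
    qed (use a in auto)
  qed
  then show ?thesis using p q usum_in_betaN by (auto simp: Jp_def)
qed

text \<open>A solution for the set of x with -x + A in p involves finitely many values. The
  corresponding translates of A meet in a member of p, so one y moves all values into A and is
  absorbed into a.\<close>

lemma usum_right_Jp:
  assumes p: "p \<in> betaN" and q: "q \<in> Jp"
  shows "q \<oplus>\<^sub>u p \<in> Jp"
proof -
  have "Jp_set A" if A: "A \<in> q \<oplus>\<^sub>u p" for A
    unfolding Jp_set_def
  proof (intro conjI ballI)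
    show "A \<subseteq> Pos" using A by (simp add: usum_iff)
    fix F H assume FH: "F \<in> Pf PP" "H \<in> Pf NN"
    let ?B = "{x \<in> Pos. {y \<in> Pos. x + y \<in> A} \<in> p}"
    have "Jp_set ?B" using A q by (auto simp: usum_iff Jp_def)
    from Jp_setD[OF this FH] obtain a \<beta> where a: "a \<in> Pos" "\<beta> \<in> Pf Pos"
      and *: "\<forall>P\<in>F. \<forall>f\<in>H. int a + poly P (\<Sum>t\<in>\<beta>. int (f t)) \<in> int ` ?B"
      by (elim bexE) (rule that)
    define v where "v = (\<lambda>(P, f). nat (int a + poly P (\<Sum>t\<in>\<beta>. int (f t))))"
    have v: "int (v (P, f)) = int a + poly P (\<Sum>t\<in>\<beta>. int (f t))"
      "{y \<in> Pos. v (P, f) + y \<in> A} \<in> p" if "P \<in> F" "f \<in> H" for P f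
      using *[rule_format, OF that] by (auto simp: v_def)
    let ?\<C> = "(\<lambda>z. {y \<in> Pos. v z + y \<in> A}) ` (F \<times> H)"
    have "Pos \<inter> \<Inter>?\<C> \<in> p"
      using FH v(2) by (intro betaN_Inter[OF p]) (auto simp: Pf_def)
    then obtain y where y: "y \<in> Pos" "\<And>P f. P \<in> F \<Longrightarrow> f \<in> H \<Longrightarrow> v (P, f) + y \<in> A"
      using betaN_nonempty[OF p, of "Pos \<inter> \<Inter>?\<C>"] by auto
    show "\<exists>a\<in>Pos. \<exists>\<beta>\<in>Pf Pos. \<forall>P\<in>F. \<forall>f\<in>H. int a + poly P (\<Sum>t\<in>\<beta>. int (f t)) \<in> int ` A"
    proof (intro bexI ballI)
      fix P f assume "P \<in> F" "f \<in> H"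
      then show "int (a + y) + poly P (\<Sum>t\<in>\<beta>. int (f t)) \<in> int ` A"
        using y v by (intro image_eqI[of _ _ "v (P, f) + y"]) auto
    qed (use a in auto)
  qed
  then show ?thesis using p q usum_in_betaN by (auto simp: Jp_def)
qed

theorem K_betaN_subset_Jp: "K_betaN \<subseteq> Jp"
proof -
  have "two_sided_ideal Jp"
    unfolding two_sided_ideal_def
  proof (intro conjI ballI)
    show "Jp \<subseteq> betaN" by (auto simp: Jp_def)
    show "p \<oplus>\<^sub>u q \<in> Jp" "q \<oplus>\<^sub>u p \<in> Jp" if "p \<in> betaN" "q \<in> Jp" for p q
      using that by (rule usum_left_Jp, rule usum_right_Jp)
  qed (rule Jp_nonempty)
  then show ?thesis unfolding K_betaN_def by blast
qed

section \<open>Polynomial central sets\<close>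

text \<open>Usually written A*, the standard device for iterating inside a member of an idempotent
  ultrafilter.\<close>

definition star :: "nat set set \<Rightarrow> nat set \<Rightarrow> nat set" where
  "star p A = {x \<in> A. {y \<in> Pos. x + y \<in> A} \<in> p}"

lemma star_in:
  assumes "idempotent p" "A \<in> p"
  shows "star p A \<in> p"
proof -
  have p: "p \<in> betaN" "A \<in> p \<oplus>\<^sub>u p" using assms by (auto simp: idempotent_def)
  have "A \<inter> {x \<in> Pos. {y \<in> Pos. x + y \<in> A} \<in> p} \<in> p"
    using p assms(2) by (intro betaN_Int) (simp_all add: usum_iff)
  moreover have "A \<inter> {x \<in> Pos. {y \<in> Pos. x + y \<in> A} \<in> p} = star p A"
    using betaN_subset[OF p(1) assms(2)] by (auto simp: star_def)
  ultimately show ?thesis by simp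
qed

text \<open>The translate -x + A belongs to p, hence so does its star set, which associativity
  places inside -x + A*.\<close>

lemma star_translate:
  assumes "idempotent p" "x \<in> star p A"
  shows "{y \<in> Pos. x + y \<in> star p A} \<in> p"
proof -
  have p: "p \<in> betaN" using assms by (auto simp: idempotent_def)
  let ?B = "{y \<in> Pos. x + y \<in> A}"
  have "?B \<in> p" using assms by (simp add: star_def)
  then have "star p ?B \<in> p" by (rule star_in[OF assms(1)])
  moreover have "star p ?B \<subseteq> {y \<in> Pos. x + y \<in> star p A}"
  proof
    fix y assume "y \<in> star p ?B"
    then have y: "y \<in> ?B" "{z \<in> Pos. y + z \<in> ?B} \<in> p"
      unfolding star_def by blast+
    moreover have "{z \<in> Pos. y + z \<in> ?B} = {z \<in> Pos. x + y + z \<in> A}"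
      by (auto simp: add.assoc)
    ultimately show "y \<in> {y \<in> Pos. x + y \<in> star p A}"
      by (simp add: star_def)
  qed
  ultimately show ?thesis by (rule betaN_mono[OF p]) auto
qed

text \<open>Translating the functions by N pushes the index set beyond N, which later yields the
  order condition on the \<open>H i\<close>. The restriction keeps the translates
  extensional.\<close>

lemma Jp_setD_above:
  assumes "Jp_set A" "F \<in> Pf PP" "H \<in> Pf NN"
  shows "\<exists>a\<in>Pos. \<exists>\<beta>\<in>Pf Pos. (\<forall>t\<in>\<beta>. N < t) \<and>
    (\<forall>P\<in>F. \<forall>f\<in>H. int a + poly P (\<Sum>t\<in>\<beta>. int (f t)) \<in> int ` A)"
proof -
  define sh where "sh = (\<lambda>f::nat \<Rightarrow> nat. restrict (\<lambda>t. f (t + N)) Pos)"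
  have "sh f \<in> NN" if "f \<in> NN" for f
    using that by (auto simp: NN_def sh_def PiE_iff)
  then have "sh ` H \<in> Pf NN"
    using assms(3) by (auto simp: Pf_def)
  from Jp_setD[OF assms(1,2) this] obtain a \<beta> where a: "a \<in> Pos" "\<beta> \<in> Pf Pos"
    and *: "\<forall>P\<in>F. \<forall>f\<in>sh ` H. int a + poly P (\<Sum>t\<in>\<beta>. int (f t)) \<in> int ` A"
    by (elim bexE) (rule that)
  have "(\<Sum>t\<in>(\<lambda>t. t + N) ` \<beta>. int (f t)) = (\<Sum>t\<in>\<beta>. int (sh f t))" for f
    using a(2) by (subst sum.reindex) (auto simp: Pf_def sh_def intro!: sum.cong)
  with * have "\<forall>P\<in>F. \<forall>f\<in>H. int a + poly P (\<Sum>t\<in>(\<lambda>t. t + N) ` \<beta>. int (f t)) \<in> int ` A"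
    by simp
  moreover have "(\<lambda>t. t + N) ` \<beta> \<in> Pf Pos" "\<forall>t\<in>(\<lambda>t. t + N) ` \<beta>. N < t"
    using a(2) by (auto simp: Pf_def)
  ultimately show ?thesis using a(1) by (intro bexI[of _ a] bexI[of _ "(\<lambda>t. t + N) ` \<beta>"] conjI)
qed

text \<open>The sets C intersect in one member of p, and the increments P(s + u) - P(s) vanish at u
  = 0, so one finite subset of \<open>PP\<close> covers all requirements.\<close>

lemma Jp_simultaneous_step:
  assumes p: "p \<in> Jp" and W: "finite W" "fst ` W \<subseteq> p"
    and G: "G \<in> Pf NN"
  shows "\<exists>a\<in>Pos. \<exists>\<beta>\<in>Pf Pos. (\<forall>t\<in>\<beta>. N < t) \<and>
    (\<forall>(C, s, P)\<in>W. \<forall>f\<in>G. int a + (poly P (s + (\<Sum>t\<in>\<beta>. int (f t))) - poly P s) \<in> int ` C)"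
proof -
  have pb: "p \<in> betaN" using p by (simp add: Jp_def)
  \<comment> \<open>No partial block of the required length need exist, so \<open>W\<close> can be
    empty; the zero polynomial keeps \<open>F\<close> nonempty.\<close>
  define F where "F = insert 0 ((\<lambda>(C, s, P). offset_poly P s - [:poly P s:]) ` W)"
  have "coeff (offset_poly P s - [:poly P s:]) 0 = 0" for P and s :: int
    by (simp add: poly_0_coeff_0[symmetric] poly_offset_poly)
  then have F: "F \<in> Pf PP" using W(1) by (auto simp: Pf_def PP_def F_def)
  define A where "A = Pos \<inter> \<Inter>(fst ` W)"
  have "A \<in> p" unfolding A_def using W by (intro betaN_Inter[OF pb]) auto
  then have "Jp_set A" using p by (simp add: Jp_def)
  from Jp_setD_above[OF this F G, of N] obtain a \<beta> where a: "a \<in> Pos" "\<beta> \<in> Pf Pos" "\<forall>t\<in>\<beta>. N < t"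
    and *: "\<forall>P\<in>F. \<forall>f\<in>G. int a + poly P (\<Sum>t\<in>\<beta>. int (f t)) \<in> int ` A"
    by (elim bexE conjE) (rule that)
  have "int a + (poly P (s + (\<Sum>t\<in>\<beta>. int (f t))) - poly P s) \<in> int ` C"
    if W: "(C, s, P) \<in> W" and f: "f \<in> G" for C s P f
  proof -
    have "offset_poly P s - [:poly P s:] \<in> F" using W by (force simp: F_def)
    from bspec[OF bspec[OF * this] f]
    have "int a + (poly P (s + (\<Sum>t\<in>\<beta>. int (f t))) - poly P s) \<in> int ` A"
      by (simp add: poly_offset_poly)
    moreover have "A \<subseteq> C" using W by (force simp: A_def)
    ultimately show ?thesis by blast
  qed
  with a show ?thesis
    by (intro bexI[of _ a] bexI[of _ \<beta>] conjI) auto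
qed

text \<open>The recursion for the tensor product passes from \<open>A\<close> to the prefixes with a
  large set of continuations. Iterated down to \<open>[]\<close>, it gives a tree in which every
  node branches along a member of the next ultrafilter.\<close>

lemma tensor_tree:
  assumes "A \<in> tensor p m"
  shows "\<exists>D. D m = A \<and> [] \<in> D 0 \<and>
    (\<forall>k<m. \<forall>xs\<in>D k. length xs = k \<and> {x \<in> Pos. xs @ [x] \<in> D (Suc k)} \<in> p (Suc k))"
  using assms
proof (induction m arbitrary: A)
  case 0
  then show ?case by (intro exI[of _ "\<lambda>_. {[]}"]) auto
next
  case (Suc m)
  let ?A = "{xs \<in> tuples m. {x \<in> Pos. xs @ [x] \<in> A} \<in> p (Suc m)}"
  have "?A \<in> tensor p m" using Suc.prems by simp
  from Suc.IH[OF this] obtain D where D: "D m = ?A" "[] \<in> D 0"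
    "\<forall>k<m. \<forall>xs\<in>D k. length xs = k \<and> {x \<in> Pos. xs @ [x] \<in> D (Suc k)} \<in> p (Suc k)"
    by blast
  show ?case
  proof (intro exI[of _ "D(Suc m := A)"] conjI allI impI ballI)
    fix k xs assume k: "k < Suc m" and xs: "xs \<in> (D(Suc m := A)) k"
    then have "xs \<in> D k" by simp
    show "length xs = k"
      using k \<open>xs \<in> D k\<close> D by (cases "k = m") (auto simp: tuples_def)
    show "{x \<in> Pos. xs @ [x] \<in> (D(Suc m := A)) (Suc k)} \<in> p (Suc k)"
      using k \<open>xs \<in> D k\<close> D by (cases "k = m") auto
  qed (use D in auto)
qed

section \<open>Partial blocks and the recursive choice of \<alpha> and H\<close>

type_synonym choice = "(nat \<Rightarrow> nat) set \<Rightarrow> nat \<Rightarrow> nat \<times> nat set"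

text \<open>Here \<open>h G j\<close> stands for the pair \<open>\<alpha>\<^sub>j(G), H\<^sub>j(G)\<close>. \<open>block h T G xs x s\<close> describes a chain ending in
  \<open>G\<close> whose completed blocks have the values \<open>xs\<close> and whose current block, containing the index of
  \<open>G\<close>, has the partial sums \<open>x\<close> of the \<open>\<alpha>\<close> and \<open>s\<close> of the \<open>f\<close>. \<open>open_block\<close> is the same just before
  \<open>G\<close> is appended, so it depends on \<open>h\<close> below \<open>G\<close> only. The polynomial of a block is chosen when
  the block is completed.\<close>

inductive open_block :: "choice \<Rightarrow> int poly set \<Rightarrow> (nat \<Rightarrow> nat) set \<Rightarrow> nat list \<Rightarrow> int \<Rightarrow> int \<Rightarrow> bool"
  and block :: "choice \<Rightarrow> int poly set \<Rightarrow> (nat \<Rightarrow> nat) set \<Rightarrow> nat list \<Rightarrow> int \<Rightarrow> int \<Rightarrow> bool"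
  for h :: choice and T :: "int poly set" where
  first: "open_block h T G [] 0 0"
| fresh: "block h T G' xs x s \<Longrightarrow> G' \<subset> G \<Longrightarrow> P \<in> T \<Longrightarrow> open_block h T G (xs @ [nat (x + poly P s)]) 0 0"
| continue: "block h T G' xs x s \<Longrightarrow> G' \<subset> G \<Longrightarrow> open_block h T G xs x s"
| close: "open_block h T G xs x s \<Longrightarrow> G \<in> Pf NN \<Longrightarrow> f \<in> G \<Longrightarrow>
    block h T G xs (x + int (fst (h G (Suc (length xs)))))
      (s + (\<Sum>t\<in>snd (h G (Suc (length xs))). int (f t)))"

lemma block_cong:
  shows "open_block h T G xs x s \<Longrightarrow> (\<And>G'. G' \<subset> G \<Longrightarrow> h G' = h' G') \<Longrightarrow> open_block h' T G xs x s"
    and "block h T G xs x s \<Longrightarrow> (\<And>G'. G' \<subseteq> G \<Longrightarrow> h G' = h' G') \<Longrightarrow> block h' T G xs x s"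
proof (induction rule: open_block_block.inducts)
  case (first G)
  show ?case by (rule open_block_block.first)
next
  case (fresh G' xs x s G P)
  then show ?case by (intro open_block_block.fresh[of _ _ G']) auto
next
  case (continue G' xs x s G)
  then show ?case by (intro open_block_block.continue[of _ _ G']) auto
next
  case (close G xs x s f)
  have "h G = h' G" using close.prems by simp
  then show ?case using close open_block_block.close[of h' T G xs x s f] by simp
qed

lemma open_block_cong:
  assumes "\<And>G'. G' \<subset> G \<Longrightarrow> h G' = h' G'"
  shows "open_block h T G = open_block h' T G"
proof (intro ext iffI)
  show "open_block h T G xs x s \<Longrightarrow> open_block h' T G xs x s" for xs x s
    by (rule block_cong(1)[OF _ assms])
  show "open_block h' T G xs x s \<Longrightarrow> open_block h T G xs x s" for xs x s
    by (rule block_cong(1)[OF _ assms[symmetric]])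
qed

text \<open>A finite set has finitely many proper subsets. Each of these turns a partial block into
  one block per function in it, and completing a block adds only a choice from
  \<open>T\<close>.\<close>

lemma finite_open_block:
  assumes "finite T" "finite G"
  shows "finite {(xs, x, s). open_block h T G xs x s}"
  using assms(2)
proof (induction G rule: finite_psubset_induct)
  case (psubset G)
  define B where "B = (\<Union>G'\<in>{G'. G' \<subset> G}. {(xs, x, s). block h T G' xs x s})"
  have "finite {(xs, x, s). block h T G' xs x s}" if "G' \<subset> G" for G'
  proof (rule finite_subset)
    show "{(xs, x, s). block h T G' xs x s} \<subseteq>
      (\<lambda>((xs, x, s), f). (xs, x + int (fst (h G' (Suc (length xs)))),
        s + (\<Sum>t\<in>snd (h G' (Suc (length xs))). int (f t)))) `
      ({(xs, x, s). open_block h T G' xs x s} \<times> G')"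
      by (force elim: block.cases)
    have "finite G'" using that psubset.hyps finite_subset by blast
    then show "finite ((\<lambda>((xs, x, s), f). (xs, x + int (fst (h G' (Suc (length xs)))),
        s + (\<Sum>t\<in>snd (h G' (Suc (length xs))). int (f t)))) `
      ({(xs, x, s). open_block h T G' xs x s} \<times> G'))"
      using psubset.IH[OF that] by blast
  qed
  moreover have "finite {G'. G' \<subset> G}"
    using psubset.hyps by (rule finite_subset[rotated, OF finite_Pow_iff[THEN iffD2]]) auto
  ultimately have "finite B" unfolding B_def by blast
  define ext where "ext = (\<lambda>((xs, x, s), P). (xs @ [nat (x + poly P s)], 0::int, 0::int))"
  show ?case
  proof (rule finite_subset)
    show "{(xs, x, s). open_block h T G xs x s} \<subseteq> {([], 0, 0)} \<union> B \<union> ext ` (B \<times> T)"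
    proof
      fix y assume "y \<in> {(xs, x, s). open_block h T G xs x s}"
      then obtain xs x s where y: "y = (xs, x, s)" "open_block h T G xs x s" by blast
      from y(2) show "y \<in> {([], 0, 0)} \<union> B \<union> ext ` (B \<times> T)"
      proof (cases rule: open_block.cases)
        case (fresh G' xs' x' s' P)
        then have "((xs', x', s'), P) \<in> B \<times> T" by (auto simp: B_def)
        then have "ext ((xs', x', s'), P) \<in> ext ` (B \<times> T)" by (rule imageI)
        moreover have "y = ext ((xs', x', s'), P)" by (simp add: y(1) fresh ext_def)
        ultimately show ?thesis by simp
      qed (auto simp: B_def y(1))
    qed
    show "finite ({([], 0, 0)} \<union> B \<union> ext ` (B \<times> T))"
      using \<open>finite B\<close> assms(1) by blast
  qed
qed

text \<open>The values admissible after the prefix xs, cut down to the star set so that a block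
  whose value lies there can still be extended.\<close>

definition node :: "(nat \<Rightarrow> nat set set) \<Rightarrow> (nat \<Rightarrow> nat list set) \<Rightarrow> nat list \<Rightarrow> nat set" where
  "node p D xs = star (p (Suc (length xs))) {x \<in> Pos. xs @ [x] \<in> D (Suc (length xs))}"

definition closes :: "(nat \<Rightarrow> nat set set) \<Rightarrow> (nat \<Rightarrow> nat list set) \<Rightarrow> int poly set \<Rightarrow>
    choice \<Rightarrow> (nat \<Rightarrow> nat) set \<Rightarrow> nat \<Rightarrow> nat \<Rightarrow> nat set \<Rightarrow> bool" where
  "closes p D T h G j a \<beta> \<longleftrightarrow> (\<forall>xs x s P f. open_block h T G xs x s \<longrightarrow> j = Suc (length xs) \<longrightarrow>
     P \<in> T \<longrightarrow> f \<in> G \<longrightarrow> x + int a + poly P (s + (\<Sum>t\<in>\<beta>. int (f t))) \<in> int ` node p D xs)"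

text \<open>\<open>r\<close> is a candidate for \<open>h G\<close>. It is kept apart from
  \<open>h\<close>, which enters only through its values on proper subsets of \<open>G\<close>, as
  dependent choice requires.\<close>

definition good :: "nat \<Rightarrow> (nat \<Rightarrow> nat set set) \<Rightarrow> (nat \<Rightarrow> nat list set) \<Rightarrow> int poly set \<Rightarrow>
    choice \<Rightarrow> (nat \<Rightarrow> nat) set \<Rightarrow> (nat \<Rightarrow> nat \<times> nat set) \<Rightarrow> bool" where
  "good m p D T h G r \<longleftrightarrow> (G \<in> Pf NN \<longrightarrow> (\<forall>j\<in>{1..m}. fst (r j) \<in> Pos \<and> snd (r j) \<in> Pf Pos \<and>
     (\<forall>G'. G' \<subset> G \<longrightarrow> G' \<in> Pf NN \<longrightarrow> snd (h G' j) \<lless> snd (r j)) \<and>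
     closes p D T h G j (fst (r j)) (snd (r j))))"

lemma good_block:
  assumes "good m p D T h G (h G)" "block h T G xs x s" "length xs < m" "P \<in> T"
  shows "x + poly P s \<in> int ` node p D xs"
  using assms(2)
proof (cases rule: block.cases)
  case (close x' s' f)
  let ?j = "Suc (length xs)"
  have "?j \<in> {1..m}" using assms(3) by simp
  with assms(1) close(4) have "closes p D T h G ?j (fst (h G ?j)) (snd (h G ?j))"
    unfolding good_def by blast
  with close assms(4) show ?thesis unfolding closes_def by simp
qed

text \<open>A block not yet begun has value P(0) = 0, so the set in question is the node itself,
  which is large by idempotence. A continued block has its value in the star set already, and the
  corresponding translate of that set is large.\<close>

lemma good_open_block:
  assumes p: "\<And>j. j \<in> {1..m} \<Longrightarrow> idempotent (p j)"
    and D: "[] \<in> D 0" "\<And>k xs. k < m \<Longrightarrow> xs \<in> D k \<Longrightarrow> {x \<in> Pos. xs @ [x] \<in> D (Suc k)} \<in> p (Suc k)"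
    and T: "T \<subseteq> PP" and h: "\<And>G'. G' \<subset> G \<Longrightarrow> good m p D T h G' (h G')"
    and block: "open_block h T G xs x s" and len: "length xs < m" and P: "P \<in> T"
  shows "{y \<in> Pos. int y + (x + poly P s) \<in> int ` node p D xs} \<in> p (Suc (length xs))"
proof -
  have idem: "idempotent (p (Suc (length xs)))" using p len by auto
  then have pb: "p (Suc (length xs)) \<in> betaN" by (simp add: idempotent_def)
  have P0: "poly P 0 = 0" using T P by (auto simp: PP_def poly_0_coeff_0)
  have start: ?thesis if "xs \<in> D (length xs)" "x = 0" "s = 0"
  proof -
    have "node p D xs \<in> p (Suc (length xs))"
      unfolding node_def using D(2)[OF len that(1)] by (rule star_in[OF idem])
    moreover from this have "{y \<in> Pos. int y + (x + poly P s) \<in> int ` node p D xs} = node p D xs"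
      using betaN_subset[OF pb] by (auto simp: that P0)
    ultimately show ?thesis by simp
  qed
  from block show ?thesis
  proof (cases rule: open_block.cases)
    case first
    with D(1) show ?thesis by (intro start) auto
  next
    case (fresh G' xs' x' s' Q)
    \<comment> \<open>The completed value lies in the node of its prefix, so the extended prefix
      stays in the tree.\<close>
    have "x' + poly Q s' \<in> int ` node p D xs'"
      using fresh len by (intro good_block[OF h]) auto
    then have "nat (x' + poly Q s') \<in> node p D xs'" by auto
    then have "xs' @ [nat (x' + poly Q s')] \<in> D (Suc (length xs'))"
      by (auto simp: node_def star_def)
    with fresh show ?thesis by (intro start) auto
  next
    case (continue G')
    then have "x + poly P s \<in> int ` node p D xs"
      using len P by (intro good_block[OF h]) auto
    then obtain v where v: "x + poly P s = int v" "v \<in> node p D xs" by auto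
    then have "{y \<in> Pos. v + y \<in> node p D xs} \<in> p (Suc (length xs))"
      using star_translate[OF idem] by (simp add: node_def)
    moreover have "int y + (x + poly P s) \<in> int ` node p D xs \<longleftrightarrow> v + y \<in> node p D xs" for y
    proof -
      have "int y + (x + poly P s) = int (v + y)" using v(1) by simp
      then show ?thesis by (simp only: inj_image_mem_iff[OF inj_of_nat])
    qed
    ultimately show ?thesis by simp
  qed
qed

lemma exists_good:
  assumes p: "\<And>j. j \<in> {1..m} \<Longrightarrow> p j \<in> Jp \<and> idempotent (p j)"
    and D: "[] \<in> D 0" "\<And>k xs. k < m \<Longrightarrow> xs \<in> D k \<Longrightarrow> {x \<in> Pos. xs @ [x] \<in> D (Suc k)} \<in> p (Suc k)"
    and T: "T \<in> Pf PP"
  shows "\<exists>h. \<forall>G. finite G \<longrightarrow> good m p D T h G (h G)"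
proof -
  have T': "finite T" "T \<subseteq> PP" using T by (auto simp: Pf_def)
  show ?thesis
  proof (rule dependent_wf_choice[OF wf_finite_psubset])
    fix h h' :: choice and G and r :: "nat \<Rightarrow> nat \<times> nat set"
    assume eq: "\<And>G'. (G', G) \<in> finite_psubset \<Longrightarrow> h G' = h' G'"
    show "(finite G \<longrightarrow> good m p D T h G r) = (finite G \<longrightarrow> good m p D T h' G r)"
    proof (rule imp_cong[OF refl])
      assume "finite G"
      then have eq': "h G' = h' G'" if "G' \<subset> G" for G' using eq that by (simp add: finite_psubset_def)
      have "open_block h T G = open_block h' T G"
        using eq' by (rule open_block_cong)
      then have "closes p D T h G = closes p D T h' G" by (simp add: closes_def fun_eq_iff)
      with eq' show "good m p D T h G r = good m p D T h' G r" by (simp add: good_def)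
    qed
  next
    fix G and h :: choice assume "\<And>G'. (G', G) \<in> finite_psubset \<Longrightarrow> finite G' \<longrightarrow> good m p D T h G' (h G')"
    then have h: "good m p D T h G' (h G')" if "finite G" "G' \<subset> G" for G'
      using that finite_subset by (auto simp: finite_psubset_def)
    show "\<exists>r. finite G \<longrightarrow> good m p D T h G r"
    proof (cases "G \<in> Pf NN")
      case True
      then have "finite G" by (simp add: Pf_def)
      have "finite (\<Union>j\<in>{1..m}. \<Union>G'\<in>{G'. G' \<subset> G \<and> G' \<in> Pf NN}. snd (h G' j))" (is "finite ?U")
      proof (intro finite_UN_I)
        show "finite {G'. G' \<subset> G \<and> G' \<in> Pf NN}"
          using \<open>finite G\<close> by (rule finite_subset[rotated, OF finite_Pow_iff[THEN iffD2]]) auto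
        fix j G' assume "j \<in> {1..m}" "G' \<in> {G'. G' \<subset> G \<and> G' \<in> Pf NN}"
        with h[OF \<open>finite G\<close>, of G'] show "finite (snd (h G' j))"
          by (auto simp: good_def Pf_def)
      qed simp
      \<comment> \<open>Index sets beyond \<open>N\<close> satisfy the order condition against
        everything chosen below \<open>G\<close>.\<close>
      then obtain N where N: "\<forall>t\<in>?U. t \<le> N" by (auto simp: finite_nat_set_iff_bounded_le)
      have "\<exists>r. fst r \<in> Pos \<and> snd r \<in> Pf Pos \<and> (\<forall>t\<in>snd r. N < t) \<and> closes p D T h G j (fst r) (snd r)"
        if j: "j \<in> {1..m}" for j
      proof -
        \<comment> \<open>Each partial block and each P contribute the set of increments y that
          bring x + P(s) into the node, with s as the point at which P is expanded.\<close>
        define tri where "tri = (\<lambda>((xs, x, s), P). ({y \<in> Pos. int y + (x + poly P s) \<in> int ` node p D xs}, s, P))"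
        define W where "W = tri ` ({(xs, x, s). open_block h T G xs x s \<and> j = Suc (length xs)} \<times> T)"
        have "finite {(xs, x, s). open_block h T G xs x s \<and> j = Suc (length xs)}"
          by (rule finite_subset[OF _ finite_open_block[OF T'(1) \<open>finite G\<close>]]) auto
        then have "finite W" using T'(1) by (simp add: W_def)
        have W: "fst ` W \<subseteq> p j"
        proof
          fix C assume "C \<in> fst ` W"
          then obtain xs x s P where C: "C = {y \<in> Pos. int y + (x + poly P s) \<in> int ` node p D xs}"
            "open_block h T G xs x s" "j = Suc (length xs)" "P \<in> T"
            by (auto simp: W_def tri_def)
          moreover have "length xs < m" using C(3) j by simp
          ultimately show "C \<in> p j"
            using good_open_block[OF conjunct2[OF p] D T'(2) h[OF \<open>finite G\<close>]] by simp
        qed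
        from Jp_simultaneous_step[OF conjunct1[OF p[OF j]] \<open>finite W\<close> W True, where N = N]
        obtain a \<beta> where a: "a \<in> Pos" "\<beta> \<in> Pf Pos" "\<forall>t\<in>\<beta>. N < t" and
          step: "\<forall>(C, s, P)\<in>W. \<forall>f\<in>G. int a + (poly P (s + (\<Sum>t\<in>\<beta>. int (f t))) - poly P s) \<in> int ` C"
          by (elim bexE conjE) (rule that)
        have "x + int a + poly P (s + (\<Sum>t\<in>\<beta>. int (f t))) \<in> int ` node p D xs"
          if "open_block h T G xs x s" "j = Suc (length xs)" "P \<in> T" "f \<in> G" for xs x s P f
        proof -
          have "tri ((xs, x, s), P) \<in> W" using that by (auto simp: W_def)
          from bspec[OF step this] that(4)
          have "int a + (poly P (s + (\<Sum>t\<in>\<beta>. int (f t))) - poly P s) \<in>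
            int ` {y \<in> Pos. int y + (x + poly P s) \<in> int ` node p D xs}"
            by (simp add: tri_def)
          then obtain y where "int a + (poly P (s + (\<Sum>t\<in>\<beta>. int (f t))) - poly P s) = int y"
            "int y + (x + poly P s) \<in> int ` node p D xs" by auto
          moreover from this(1) have "x + int a + poly P (s + (\<Sum>t\<in>\<beta>. int (f t))) = int y + (x + poly P s)"
            by simp
          ultimately show ?thesis by (simp only:)
        qed
        then have "closes p D T h G j a \<beta>" unfolding closes_def by (intro allI impI)
        with a show ?thesis by (intro exI[of _ "(a, \<beta>)"]) simp
      qed
      then obtain r where r: "\<And>j. j \<in> {1..m} \<Longrightarrow> fst (r j) \<in> Pos \<and> snd (r j) \<in> Pf Pos \<and>
        (\<forall>t\<in>snd (r j). N < t) \<and> closes p D T h G j (fst (r j)) (snd (r j))"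
        by metis
      have "snd (h G' j) \<lless> snd (r j)" if "j \<in> {1..m}" "G' \<subset> G" "G' \<in> Pf NN" for j G'
      proof -
        have "snd (h G' j) \<in> Pf Pos" using h[OF \<open>finite G\<close> that(2)] that by (auto simp: good_def)
        then have ne: "finite (snd (h G' j))" "snd (h G' j) \<noteq> {}" by (auto simp: Pf_def)
        then have "Max (snd (h G' j)) \<le> N" using N that by (subst Max_le_iff) auto
        moreover have "finite (snd (r j))" "snd (r j) \<noteq> {}" "\<forall>t\<in>snd (r j). N < t"
          using r[OF that(1)] by (auto simp: Pf_def)
        then have "N < Min (snd (r j))" by simp
        ultimately show ?thesis by (simp add: set_less_def)
      qed
      with r have "good m p D T h G r" unfolding good_def by simp
      then show ?thesis by blast
    qed (auto simp: good_def)
  qed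
qed

section \<open>From chains of sets to tuples in \<open>A\<close>\<close>

lemma block_of_chain:
  fixes G :: "nat \<Rightarrow> (nat \<Rightarrow> nat) set"
  assumes "finite B" "B \<noteq> {}"
    and G: "\<And>i. i \<in> B \<Longrightarrow> G i \<in> Pf NN \<and> f i \<in> G i"
    and mono: "\<And>i k. i \<in> B \<Longrightarrow> k \<in> B \<Longrightarrow> i < k \<Longrightarrow> G i \<subset> G k"
    and start: "\<And>i. i \<in> B \<Longrightarrow> open_block h T (G i) xs 0 0"
    and j: "j = Suc (length xs)"
  shows "block h T (G (Max B)) xs (\<Sum>i\<in>B. int (fst (h (G i) j)))
    (\<Sum>i\<in>B. \<Sum>t\<in>snd (h (G i) j). int (f i t))"
  using assms(1-5)
proof (induction B rule: finite_linorder_max_induct)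
  case (insert b B)
  have max: "Max (insert b B) = b"
    using insert.hyps by (intro Max_eqI) auto
  have "b \<notin> B" using insert.hyps by blast
  show ?case
  proof (cases "B = {}")
    case True
    then show ?thesis
      using open_block_block.close[OF insert.prems(4), of b "f b"] insert.prems(2)[of b] j by simp
  next
    case False
    then have "block h T (G (Max B)) xs (\<Sum>i\<in>B. int (fst (h (G i) j)))
        (\<Sum>i\<in>B. \<Sum>t\<in>snd (h (G i) j). int (f i t))"
      using insert.prems by (intro insert.IH) auto
    \<comment> \<open>Indices are added in increasing order: the block ending at the previous
      maximum continues to \<open>b\<close>, across any skipped indices.\<close>
    moreover have "G (Max B) \<subset> G b"
      using insert.hyps False by (intro insert.prems(3)) auto
    ultimately have "open_block h T (G b) xs (\<Sum>i\<in>B. int (fst (h (G i) j)))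
        (\<Sum>i\<in>B. \<Sum>t\<in>snd (h (G i) j). int (f i t))"
      by (rule open_block_block.continue)
    from open_block_block.close[OF this, of "f b"] show ?thesis
      using insert.prems(2)[of b] insert.hyps \<open>b \<notin> B\<close> j by (simp add: max add.commute)
  qed
qed simp

lemma polynomial_central_conclusion_Jp:
  assumes "m \<ge> 1" and p: "\<And>j. j \<in> {1..m} \<Longrightarrow> p j \<in> Jp \<and> idempotent (p j)"
    and A: "A \<in> tensor p m" and T: "T \<in> Pf PP"
  shows "polynomial_central_conclusion m A T"
proof -
  obtain D where D: "D m = A" "[] \<in> D 0"
    "\<And>k xs. k < m \<Longrightarrow> xs \<in> D k \<Longrightarrow> {x \<in> Pos. xs @ [x] \<in> D (Suc k)} \<in> p (Suc k)"
    using tensor_tree[OF A] by metis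
  from exists_good[OF p D(2,3) T] obtain h where
    h: "\<And>G. finite G \<Longrightarrow> good m p D T h G (h G)" by blast
  have good: "fst (h G j) \<in> Pos" "snd (h G j) \<in> Pf Pos"
    "\<And>G'. G' \<subset> G \<Longrightarrow> G' \<in> Pf NN \<Longrightarrow> snd (h G' j) \<lless> snd (h G j)"
    if "G \<in> Pf NN" "j \<in> {1..m}" for G j
    using h[of G] that unfolding good_def by (auto simp: Pf_def)
  have main: "map (\<lambda>j. (\<Sum>i\<in>\<beta> j. int (fst (h (G i) j))) +
      poly (P j) (\<Sum>i\<in>\<beta> j. \<Sum>t\<in>snd (h (G i) j). int (f i t))) [1..<Suc m] \<in> map int ` A"
    if n: "m \<le> n" and G: "\<forall>i\<in>{1..n}. G i \<in> Pf NN" and chain: "\<forall>i\<in>{1..<n}. G i \<subset> G (Suc i)"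
      and \<beta>: "\<forall>j\<in>{1..m}. \<beta> j \<in> Pf Pos" and \<beta>_less: "\<forall>j\<in>{1..<m}. \<beta> j \<lless> \<beta> (Suc j)"
      and max: "Max (\<beta> m) \<le> n" and f: "\<forall>i\<in>{1..n}. f i \<in> G i" and P: "\<forall>j\<in>{1..m}. P j \<in> T"
    for n and G :: "nat \<Rightarrow> (nat \<Rightarrow> nat) set" and \<beta> f P
  proof -
    have G_mono: "G i \<subset> G k" if "1 \<le> i" "i < k" "k \<le> n" for i k
      using that(2,3)
    proof (induction k)
      case (Suc k)
      then have "G k \<subset> G (Suc k)" using chain that(1) by auto
      with Suc show ?case by (cases "i = k") auto
    qed simp
    have fin: "finite (\<beta> j)" "\<beta> j \<noteq> {}" if "j \<in> {1..m}" for j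
      using \<beta> that by (auto simp: Pf_def)
    have max_le: "Max (\<beta> j) \<le> n" if "1 \<le> j" "j \<le> m" for j
      using that(2,1)
    proof (induction j rule: inc_induct)
      case (step j)
      then have "Max (\<beta> j) < Min (\<beta> (Suc j))" using \<beta>_less by (auto simp: set_less_def)
      also have "\<dots> \<le> Max (\<beta> (Suc j))" using fin[of "Suc j"] step.hyps by (intro Min_le Max_in) auto
      also have "\<dots> \<le> n" using step by simp
      finally show ?case by simp
    qed (rule max)
    have \<beta>_sub: "\<beta> j \<subseteq> {1..n}" if "j \<in> {1..m}" for j
    proof
      fix i assume i: "i \<in> \<beta> j"
      then have "i \<le> Max (\<beta> j)" using fin(1)[OF that] by simp
      also have "\<dots> \<le> n" using that by (intro max_le) auto
      finally have "i \<le> n" .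
      moreover have "\<beta> j \<subseteq> Pos" using \<beta> that by (simp add: Pf_def)
      ultimately show "i \<in> {1..n}" using i by auto
    qed
    define x where "x = (\<lambda>j. \<Sum>i\<in>\<beta> j. int (fst (h (G i) j)))"
    define s where "s = (\<lambda>j. \<Sum>i\<in>\<beta> j. \<Sum>t\<in>snd (h (G i) j). int (f i t))"
    \<comment> \<open>The values of the blocks before the j-th. They turn out nonnegative in
      \<open>nonneg\<close>, so \<open>nat\<close> loses nothing.\<close>
    define xs where "xs = (\<lambda>j. map (\<lambda>l. nat (x l + poly (P l) (s l))) [1..<j])"
    have block: "block h T (G (Max (\<beta> j))) (xs j) (x j) (s j)"
      if "j \<in> {1..m}" and start: "\<And>i. i \<in> \<beta> j \<Longrightarrow> open_block h T (G i) (xs j) 0 0" for j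
      unfolding x_def s_def
    proof (rule block_of_chain[OF fin[OF that(1)] _ _ start])
      fix i k assume "i \<in> \<beta> j"
      then have i: "i \<in> {1..n}" using \<beta>_sub[OF that(1)] by blast
      then show "G i \<in> Pf NN \<and> f i \<in> G i" using G f by blast
      assume "k \<in> \<beta> j" "i < k"
      then show "G i \<subset> G k" using i \<beta>_sub[OF that(1)] by (intro G_mono) auto
    next
      show "j = Suc (length (xs j))" using that(1) by (simp add: xs_def)
    qed
    have blocks: "block h T (G (Max (\<beta> j))) (xs j) (x j) (s j)" if "1 \<le> j" "j \<le> m" for j
      using that
    proof (induction j rule: nat_induct_at_least)
      case base
      have "xs 1 = []" by (simp add: xs_def)
      then show ?case using base by (intro block) (auto intro: open_block_block.first)
    next
      case (Suc j)
      have xs_Suc: "xs (Suc j) = xs j @ [nat (x j + poly (P j) (s j))]"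
        using Suc.hyps by (simp add: xs_def)
      show ?case
      proof (rule block)
        fix i assume i: "i \<in> \<beta> (Suc j)"
        have "Max (\<beta> j) < Min (\<beta> (Suc j))" using \<beta>_less Suc by (auto simp: set_less_def)
        also have "\<dots> \<le> i" using fin[of "Suc j"] Suc.prems i by (intro Min_le) auto
        finally have "Max (\<beta> j) < i" .
        moreover have "Max (\<beta> j) \<in> {1..n}"
          using Max_in[OF fin, of j] \<beta>_sub[of j] Suc by auto
        moreover have "i \<le> n" using \<beta>_sub[of "Suc j"] Suc.prems i by auto
        \<comment> \<open>The last set of block j lies properly below every set of the next block,
          so that block can start afresh after it.\<close>
        ultimately have "G (Max (\<beta> j)) \<subset> G i" by (intro G_mono) auto
        then show "open_block h T (G i) (xs (Suc j)) 0 0"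
          unfolding xs_Suc using Suc P by (intro open_block_block.fresh[of h T "G (Max (\<beta> j))"]) auto
      qed (use Suc in auto)
    qed
    have node: "x j + poly (P j) (s j) \<in> int ` node p D (xs j)" if "1 \<le> j" "j \<le> m" for j
    proof (rule good_block[OF h blocks[OF that]])
      have "Max (\<beta> j) \<in> {1..n}" using Max_in[OF fin, of j] \<beta>_sub[of j] that by auto
      with G show "finite (G (Max (\<beta> j)))" by (auto simp: Pf_def)
    qed (use that P in \<open>auto simp: xs_def\<close>)
    then have nonneg: "x j + poly (P j) (s j) \<ge> 0" if "1 \<le> j" "j \<le> m" for j
      using that by force
    have "nat (x m + poly (P m) (s m)) \<in> node p D (xs m)"
      using node[OF assms(1)] by auto
    then have "xs m @ [nat (x m + poly (P m) (s m))] \<in> A"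
      using assms(1) D(1) by (simp add: node_def star_def xs_def)
    moreover have "map (\<lambda>j. x j + poly (P j) (s j)) [1..<Suc m] =
        map int (xs m @ [nat (x m + poly (P m) (s m))])"
      using assms(1) nonneg by (auto simp: xs_def)
    ultimately show ?thesis unfolding x_def s_def by (intro image_eqI)
  qed
  show ?thesis
    unfolding polynomial_central_conclusion_def
  proof (intro exI[of _ "\<lambda>j G. fst (h G j)"] exI[of _ "\<lambda>j G. snd (h G j)"] conjI)
    show "\<forall>j\<in>{1..m}. (\<lambda>G. fst (h G j)) \<in> Pf NN \<rightarrow> Pos"
      "\<forall>j\<in>{1..m}. (\<lambda>G. snd (h G j)) \<in> Pf NN \<rightarrow> Pf Pos"
      "\<forall>G\<in>Pf NN. \<forall>K\<in>Pf NN. G \<subset> K \<longrightarrow> (\<forall>j\<in>{1..m}. snd (h G j) \<lless> snd (h K j))"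
      using good by auto
  qed (intro allI impI; elim conjE; rule main; assumption)
qed

theorem theorem1p29:
  fixes m :: nat and p :: "nat \<Rightarrow> nat set set"
  assumes "m \<ge> 1"
  shows "((\<forall>i\<in>{1..m}. minimal_idempotent (p i)) \<longrightarrow>
            (\<forall>A\<in>tensor p m. \<forall>T\<in>Pf PP. polynomial_central_conclusion m A T)) \<and>
         ((\<forall>i\<in>{1..m}. p i \<in> Jp \<and> idempotent (p i)) \<longrightarrow>
            (\<forall>A\<in>tensor p m. \<forall>T\<in>Pf PP. polynomial_central_conclusion m A T))"
proof (intro conjI impI ballI)
  fix A T assume AT: "A \<in> tensor p m" "T \<in> Pf PP"
  show "polynomial_central_conclusion m A T" if "\<forall>i\<in>{1..m}. minimal_idempotent (p i)"
    using that K_betaN_subset_Jp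
    by (intro polynomial_central_conclusion_Jp[OF assms _ AT]) (auto simp: minimal_idempotent_def)
  show "polynomial_central_conclusion m A T" if "\<forall>i\<in>{1..m}. p i \<in> Jp \<and> idempotent (p i)"
    using that by (intro polynomial_central_conclusion_Jp[OF assms _ AT]) auto
qed

end
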